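(* Let $\hat{\mathfrak g}$ be the untwisted affine Lie algebra of a simple finite-dimensional complex Lie algebra $\mathfrak g$, with standard Borel subalgebra $\hat{\mathfrak b}$. Then: (a) For any $\alpha\in D$ the space $\mathfrak i(\alpha)$ is a basic ideal in $\hat{\mathfrak b}$. (b) If $\mathfrak j$ is a basic ideal in $\hat{\mathfrak b}$ such that $\mathfrak j_\alpha:=\mathfrak j\cap\hat{\mathfrak g}_\alpha\neq0$ for some $\alpha\in D$, then $\mathfrak j\supset\mathfrak i(\alpha)$. (c) If $\mathfrak j$ is a basic ideal in $\hat{\mathfrak b}$, then $\displaystyle \mathfrak j=\sum_{\alpha\in D\cap\mathrm{supp}(\mathfrak j)}\mathfrak i(\alpha)$. (d) There is a bijection between the set of basic ideals in $\hat{\mathfrak b}$ and the set of nonempty anti-chains of the finite poset $(D,\preceq)$. (e) There is a bijection between the set of basic ideals in $\hat{\mathfrak b}$ and the set of submodules of the $\hat{\mathfrak b}$-module $\hat{\mathfrak n}_+/\mathfrak i(\delta)$.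
   Context: **Affine algebra.** Let $\mathfrak g=\mathfrak n_-\oplus\mathfrak h\oplus\mathfrak n_+$ be a triangular decomposition, $\Delta=\Delta_+\cup\Delta_-$ the root system of $\mathfrak g$. The untwisted affine Lie algebra $\hat{\mathfrak g}=\mathfrak g\otimes\mathbb C[t,t^{-1}]\oplus\mathbb Cc\oplus\mathbb Cd$ is obtained from the loop algebra (bracket $[x\otimes t^k,y\otimes t^l]=[x,y]\otimes t^{k+l}$) by the universal central extension (center $\mathbb Cc$) and by adjoining the derivation $d$, $[d,x\otimes t^k]=k\,x\otimes t^k$. Put $\hat{\mathfrak h}=\mathfrak h\oplus\mathbb Cc\oplus\mathbb Cd$; $\hat{\mathfrak n}_+$ is spanned by $\mathfrak n_+\otimes 1$ and all $x\otimes t^k$ with $x\in\mathfrak g$, $k>0$; $\hat{\mathfrak b}=\hat{\mathfrak h}\oplus\hat{\mathfrak n}_+$. $\hat{\mathfrak g}_\alpha$ is the root space of a root $\alpha$; $\delta$ is the indivisible positive imaginary root (so $\hat{\mathfrak g}_{\delta}=\mathfrak h\otimes t$); $\Delta$ is viewed as a set of roots of $\hat{\mathfrak g}$ via $x\mapsto x\otimes1$; $\hat\Delta_+$ is the set of roots of $\hat{\mathfrak n}_+$. **The sets $D_k$.** $D=D_0=\Delta_+\cup\{\delta\}\cup\{\alpha+\delta:\alpha\in\Delta_-\}$, $D_k=D+k\delta$ for $k>0$, and $D'=\bigcup_{k>0}D_k$. **Ideals.** An ideal $\mathfrak i$ of $\hat{\mathfrak b}$ is *strong* if it has finite codimension in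 $\hat{\mathfrak b}$ and $\mathfrak i\subset\hat{\mathfrak n}_+$; *thick* if for every root $\alpha$, $\mathfrak i\cap\hat{\mathfrak g}_\alpha\ne0$ implies $\hat{\mathfrak g}_\alpha\subset\mathfrak i$; *combinatorial* if strong and thick. For combinatorial $\mathfrak i$, $\mathrm{supp}(\mathfrak i)$ is the set of roots $\alpha$ with $\hat{\mathfrak g}_\alpha\subset\mathfrak i$. A combinatorial ideal $\mathfrak i$ is *basic* if $\mathrm{supp}(\mathfrak i)\cap D\ne\varnothing$. **The order $\preceq$ and the spaces $\mathfrak i(\alpha)$.** For $\alpha\in D$ set $\overline\alpha_0=\{\alpha\}$ and, for $i>0$, $\overline\alpha_i=\overline\alpha_{i-1}\cup\{\gamma\in D:\ \gamma=\xi+\beta\text{ for some }\xi\in\hat\Delta_+,\ \beta\in\overline\alpha_{i-1}\}$. This increasing sequence of subsets of the finite set $D$ stabilizes; let $\overline\alpha$ be its union. For $\alpha,\beta\in D$ put $\alpha\preceq\beta$ iff $\beta\in\overline\alpha$ (a partial order on $D$). Define $$\mathfrak i(\alpha):=\bigoplus_{\beta\in\overline\alpha\cup D'}\hat{\mathfrak g}_\beta .$$ *)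

theory Defs
  imports
    Complex_Main
    "HOL-Library.Poly_Mapping"
    "HOL-Library.Product_Plus"
    "HOL-Library.Function_Algebras"
    "HOL-Library.Set_Algebras"
begin

section \<open>Complex Lie algebras\<close>

record 'v lie =
  scl :: "complex \<Rightarrow> 'v \<Rightarrow> 'v"
  br :: "'v \<Rightarrow> 'v \<Rightarrow> 'v"

abbreviation lspan :: "'v::ab_group_add lie \<Rightarrow> 'v set \<Rightarrow> 'v set" where
  "lspan L \<equiv> module.span (scl L)"

locale lie_algebra = vector_space "scl L" for L :: "'v::ab_group_add lie" +
  assumes linear_br_right: "\<And>x. Vector_Spaces.linear (scl L) (scl L) (\<lambda>y. br L x y)"
    and linear_br_left: "\<And>y. Vector_Spaces.linear (scl L) (scl L) (\<lambda>x. br L x y)"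
    and br_self: "\<And>x. br L x x = 0"
    and jacobi: "\<And>x y z. br L x (br L y z) + br L y (br L z x) + br L z (br L x y) = 0"

definition lie_ideal :: "'v::ab_group_add lie \<Rightarrow> 'v set \<Rightarrow> 'v set \<Rightarrow> bool" where
  "lie_ideal L B I \<longleftrightarrow>
     I \<subseteq> B \<and> module.subspace (scl L) I \<and> (\<forall>x\<in>B. \<forall>y\<in>I. br L x y \<in> I)"

locale simple_lie_algebra = lie_algebra L for L :: "'v::ab_group_add lie" +
  assumes non_abelian: "\<exists>x y. br L x y \<noteq> 0"
    and simple: "\<And>I. lie_ideal L UNIV I \<Longrightarrow> I = {0} \<or> I = UNIV"

definition finite_dimensional :: "'v::ab_group_add lie \<Rightarrow> bool" where
  "finite_dimensional L \<longleftrightarrow> (\<exists>F. finite F \<and> lspan L F = UNIV)"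

text \<open>On a simple Lie algebra the nonzero invariant symmetric bilinear forms are exactly the
  nonzero multiples of the Killing form.\<close>

definition invariant_form :: "'v::ab_group_add lie \<Rightarrow> ('v \<Rightarrow> 'v \<Rightarrow> complex) \<Rightarrow> bool" where
  "invariant_form L \<kappa> \<longleftrightarrow>
     (\<forall>x. Vector_Spaces.linear (scl L) (*) (\<kappa> x)) \<and>
     (\<forall>x y. \<kappa> x y = \<kappa> y x) \<and>
     (\<forall>x y z. \<kappa> (br L x y) z = \<kappa> x (br L y z)) \<and>
     (\<exists>x y. \<kappa> x y \<noteq> 0)"

text \<open>Cartan subalgebras in the form used for semisimple complex Lie algebras: commutative,
  equal to their own centralizer, and acting by diagonalizable operators.\<close>

definition cartan_subalgebra :: "'v::ab_group_add lie \<Rightarrow> 'v set \<Rightarrow> bool" where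
  "cartan_subalgebra L H \<longleftrightarrow>
     module.subspace (scl L) H \<and>
     (\<forall>h\<in>H. \<forall>k\<in>H. br L h k = 0) \<and>
     (\<forall>x. (\<forall>h\<in>H. br L h x = 0) \<longrightarrow> x \<in> H) \<and>
     (\<forall>h\<in>H. lspan L {x. \<exists>c. br L h x = scl L c x} = UNIV)"

text \<open>A linear functional on a subspace \<open>H\<close> is represented by a function on the whole type
  that vanishes outside \<open>H\<close>, so that equality and pointwise addition are those of the dual
  space of \<open>H\<close>.\<close>

definition dual_space :: "'v::ab_group_add lie \<Rightarrow> 'v set \<Rightarrow> ('v \<Rightarrow> complex) set" where
  "dual_space L H =
     {\<alpha>. (\<forall>x\<in>H. \<forall>y\<in>H. \<alpha> (x + y) = \<alpha> x + \<alpha> y) \<and>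
         (\<forall>c. \<forall>x\<in>H. \<alpha> (scl L c x) = c * \<alpha> x) \<and>
         (\<forall>x. x \<notin> H \<longrightarrow> \<alpha> x = 0)}"

definition root_space :: "'v::ab_group_add lie \<Rightarrow> 'v set \<Rightarrow> ('v \<Rightarrow> complex) \<Rightarrow> 'v set" where
  "root_space L H \<alpha> = {x. \<forall>h\<in>H. br L h x = scl L (\<alpha> h) x}"

definition roots :: "'v::ab_group_add lie \<Rightarrow> 'v set \<Rightarrow> ('v \<Rightarrow> complex) set" where
  "roots L H = {\<alpha> \<in> dual_space L H. \<alpha> \<noteq> 0 \<and> root_space L H \<alpha> \<noteq> {0}}"

definition positive_system ::
    "'v::ab_group_add lie \<Rightarrow> 'v set \<Rightarrow> ('v \<Rightarrow> complex) set \<Rightarrow> bool" where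
  "positive_system L H P \<longleftrightarrow>
     P \<subseteq> roots L H \<and>
     (\<forall>\<alpha>\<in>roots L H. \<alpha> \<in> P \<longleftrightarrow> - \<alpha> \<notin> P) \<and>
     (\<forall>\<alpha>\<in>P. \<forall>\<beta>\<in>P. \<alpha> + \<beta> \<in> roots L H \<longrightarrow> \<alpha> + \<beta> \<in> P)"

definition n_plus ::
    "'v::ab_group_add lie \<Rightarrow> 'v set \<Rightarrow> ('v \<Rightarrow> complex) set \<Rightarrow> 'v set" where
  "n_plus L H P = lspan L (\<Union>\<alpha>\<in>P. root_space L H \<alpha>)"

section \<open>The untwisted affine Lie algebra\<close>

text \<open>The triple \<open>(p, u, v)\<close> stands for \<open>p + u c + v d\<close>, where the finitely supported
  function \<open>p\<close> is the Laurent polynomial with coefficient \<open>lookup p k\<close> at \<open>t^k\<close>.\<close>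

type_synonym 'g aff = "(int \<Rightarrow>\<^sub>0 'g) \<times> complex \<times> complex"

definition loop_br :: "'g::ab_group_add lie \<Rightarrow> (int \<Rightarrow>\<^sub>0 'g) \<Rightarrow> (int \<Rightarrow>\<^sub>0 'g) \<Rightarrow> (int \<Rightarrow>\<^sub>0 'g)" where
  "loop_br L p q =
     (\<Sum>k\<in>Poly_Mapping.keys p. \<Sum>l\<in>Poly_Mapping.keys q. Poly_Mapping.single (k + l) (br L (Poly_Mapping.lookup p k) (Poly_Mapping.lookup q l)))"

definition loop_cocycle ::
    "('g::ab_group_add \<Rightarrow> 'g \<Rightarrow> complex) \<Rightarrow> (int \<Rightarrow>\<^sub>0 'g) \<Rightarrow> (int \<Rightarrow>\<^sub>0 'g) \<Rightarrow> complex" where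
  "loop_cocycle \<kappa> p q = (\<Sum>k\<in>Poly_Mapping.keys p. of_int k * \<kappa> (Poly_Mapping.lookup p k) (Poly_Mapping.lookup q (- k)))"

definition loop_deriv :: "'g::ab_group_add lie \<Rightarrow> (int \<Rightarrow>\<^sub>0 'g) \<Rightarrow> (int \<Rightarrow>\<^sub>0 'g)" where
  "loop_deriv L p = (\<Sum>k\<in>Poly_Mapping.keys p. Poly_Mapping.single k (scl L (of_int k) (Poly_Mapping.lookup p k)))"

text \<open>For simple \<open>L\<close> and any nonzero invariant form \<open>\<kappa>\<close>, the cocycle above defines the universal
  central extension of the loop algebra; rescaling \<open>\<kappa>\<close> amounts to rescaling \<open>c\<close>.\<close>

definition affine ::
    "'g::ab_group_add lie \<Rightarrow> ('g \<Rightarrow> 'g \<Rightarrow> complex) \<Rightarrow> 'g aff lie" where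
  "affine L \<kappa> =
     \<lparr>scl = (\<lambda>a (p, u, v). (Poly_Mapping.map (scl L a) p, a * u, a * v)),
      br = (\<lambda>(p, u, v) (q, u', v').
        (loop_br L p q + Poly_Mapping.map (scl L v) (loop_deriv L q)
           - Poly_Mapping.map (scl L v') (loop_deriv L p),
         loop_cocycle \<kappa> p q, 0))\<rparr>"

definition tens :: "'g::ab_group_add \<Rightarrow> int \<Rightarrow> 'g aff" where
  "tens x k = (Poly_Mapping.single k x, 0, 0)"

definition aff_c :: "'g::ab_group_add aff" where "aff_c = (0, 1, 0)"

definition aff_d :: "'g::ab_group_add aff" where "aff_d = (0, 0, 1)"

lemma (in lie_algebra) affine_bracket:
  assumes K: "invariant_form L \<kappa>"
  shows "br (affine L \<kappa>) (tens x k) (tens y l) = tens (br L x y) (k + l) +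
      scl (affine L \<kappa>) (if k + l = 0 then of_int k * \<kappa> x y else 0) aff_c"
    and "br (affine L \<kappa>) aff_d (tens x k) = scl (affine L \<kappa>) (of_int k) (tens x k)"
    and "br (affine L \<kappa>) (tens x k) aff_d = - scl (affine L \<kappa>) (of_int k) (tens x k)"
    and "br (affine L \<kappa>) aff_c z = 0"
    and "br (affine L \<kappa>) z aff_c = 0"
proof -
  have br0: "br L x 0 = 0" "br L 0 x = 0" for x
    using module_hom.zero[OF Vector_Spaces.linear.axioms(3)[OF linear_br_right]]
      module_hom.zero[OF Vector_Spaces.linear.axioms(3)[OF linear_br_left]] by auto
  have k0: "\<kappa> z 0 = 0" for z
    using K module_hom.zero[OF Vector_Spaces.linear.axioms(3)] unfolding invariant_form_def by blast
  hence k0': "\<kappa> 0 z = 0" for z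
    using K unfolding invariant_form_def by metis
  have map_single:
    "Poly_Mapping.map (scl L a) (Poly_Mapping.single k x) = Poly_Mapping.single k (scl L a x)"
    for a x and k :: int
    by (rule poly_mapping_eqI) (auto simp: Poly_Mapping.map.rep_eq lookup_single when_def)
  have map_zero: "Poly_Mapping.map (scl L a) 0 = (0 :: int \<Rightarrow>\<^sub>0 'v)" for a
    by (rule poly_mapping_eqI) (auto simp: Poly_Mapping.map.rep_eq when_def)
  have map_scl0: "Poly_Mapping.map (scl L 0) p = 0" for p :: "int \<Rightarrow>\<^sub>0 'v"
    by (rule poly_mapping_eqI) (auto simp: Poly_Mapping.map.rep_eq when_def)
  note defs = affine_def tens_def aff_c_def aff_d_def loop_br_def loop_cocycle_def loop_deriv_def
  have e: "l = - k \<longleftrightarrow> k + l = 0" "- k = l \<longleftrightarrow> k + l = 0" by arith+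
  show "br (affine L \<kappa>) (tens x k) (tens y l) = tens (br L x y) (k + l) +
      scl (affine L \<kappa>) (if k + l = 0 then of_int k * \<kappa> x y else 0) aff_c"
    by (auto simp: defs map_single map_zero map_scl0 lookup_single when_def br0 k0 k0' e)
  show "br (affine L \<kappa>) aff_d (tens x k) = scl (affine L \<kappa>) (of_int k) (tens x k)"
    by (auto simp: defs map_single map_zero map_scl0)
  show "br (affine L \<kappa>) (tens x k) aff_d = - scl (affine L \<kappa>) (of_int k) (tens x k)"
    by (auto simp: defs map_single map_zero map_scl0 single_uminus k0)
  show "br (affine L \<kappa>) aff_c z = 0" "br (affine L \<kappa>) z aff_c = 0"
    by (cases z; auto simp: defs map_zero map_scl0 zero_prod_def k0)+
qed

definition aff_cartan :: "'g::ab_group_add set \<Rightarrow> 'g aff set" where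
  "aff_cartan H = {(Poly_Mapping.single 0 h, u, v) | h u v. h \<in> H}"

definition aff_n_plus ::
    "'g::ab_group_add lie \<Rightarrow> ('g \<Rightarrow> 'g \<Rightarrow> complex) \<Rightarrow> 'g set \<Rightarrow> ('g \<Rightarrow> complex) set \<Rightarrow> 'g aff set"
  where
  "aff_n_plus L \<kappa> H P =
     lspan (affine L \<kappa>) ({tens x 0 | x. x \<in> n_plus L H P} \<union> {tens x k | x k. k > 0})"

definition aff_borel ::
    "'g::ab_group_add lie \<Rightarrow> ('g \<Rightarrow> 'g \<Rightarrow> complex) \<Rightarrow> 'g set \<Rightarrow> ('g \<Rightarrow> complex) set \<Rightarrow> 'g aff set"
  where
  "aff_borel L \<kappa> H P = aff_cartan H + aff_n_plus L \<kappa> H P"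

abbreviation aff_root_space ::
    "'g::ab_group_add lie \<Rightarrow> ('g \<Rightarrow> 'g \<Rightarrow> complex) \<Rightarrow> 'g set \<Rightarrow> ('g aff \<Rightarrow> complex) \<Rightarrow> 'g aff set"
  where
  "aff_root_space L \<kappa> H \<equiv> root_space (affine L \<kappa>) (aff_cartan H)"

abbreviation aff_roots ::
    "'g::ab_group_add lie \<Rightarrow> ('g \<Rightarrow> 'g \<Rightarrow> complex) \<Rightarrow> 'g set \<Rightarrow> ('g aff \<Rightarrow> complex) set" where
  "aff_roots L \<kappa> H \<equiv> roots (affine L \<kappa>) (aff_cartan H)"

definition aff_pos_roots ::
    "'g::ab_group_add lie \<Rightarrow> ('g \<Rightarrow> 'g \<Rightarrow> complex) \<Rightarrow> 'g set \<Rightarrow> ('g \<Rightarrow> complex) set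
       \<Rightarrow> ('g aff \<Rightarrow> complex) set" where
  "aff_pos_roots L \<kappa> H P =
     {\<alpha> \<in> aff_roots L \<kappa> H. aff_root_space L \<kappa> H \<alpha> \<inter> aff_n_plus L \<kappa> H P \<noteq> {0}}"

text \<open>The functional \<open>\<delta>\<close> takes \<open>h + u c + v d\<close> to \<open>v\<close>; a functional \<open>\<alpha>\<close> on \<open>H\<close> is
  extended by zero on \<open>c\<close> and \<open>d\<close>.\<close>

definition aff_delta :: "'g::ab_group_add set \<Rightarrow> 'g aff \<Rightarrow> complex" where
  "aff_delta H = (\<lambda>z. if z \<in> aff_cartan H then snd (snd z) else 0)"

definition aff_lift :: "'g::ab_group_add set \<Rightarrow> ('g \<Rightarrow> complex) \<Rightarrow> 'g aff \<Rightarrow> complex" where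
  "aff_lift H \<alpha> = (\<lambda>z. if z \<in> aff_cartan H then \<alpha> (Poly_Mapping.lookup (fst z) 0) else 0)"

section \<open>Basic ideals\<close>

definition D0 :: "'g::ab_group_add set \<Rightarrow> ('g \<Rightarrow> complex) set \<Rightarrow> ('g aff \<Rightarrow> complex) set" where
  "D0 H P = aff_lift H ` P \<union> {aff_delta H} \<union> {aff_lift H (- \<alpha>) + aff_delta H | \<alpha>. \<alpha> \<in> P}"

definition Dk ::
    "'g::ab_group_add set \<Rightarrow> ('g \<Rightarrow> complex) set \<Rightarrow> nat \<Rightarrow> ('g aff \<Rightarrow> complex) set" where
  "Dk H P k = {\<lambda>z. \<alpha> z + of_nat k * aff_delta H z | \<alpha>. \<alpha> \<in> D0 H P}"

definition D' :: "'g::ab_group_add set \<Rightarrow> ('g \<Rightarrow> complex) set \<Rightarrow> ('g aff \<Rightarrow> complex) set" where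
  "D' H P = (\<Union>k\<in>{0<..}. Dk H P k)"

definition strong_ideal ::
    "'g::ab_group_add lie \<Rightarrow> ('g \<Rightarrow> 'g \<Rightarrow> complex) \<Rightarrow> 'g set \<Rightarrow> ('g \<Rightarrow> complex) set
       \<Rightarrow> 'g aff set \<Rightarrow> bool" where
  "strong_ideal L \<kappa> H P I \<longleftrightarrow>
     lie_ideal (affine L \<kappa>) (aff_borel L \<kappa> H P) I \<and>
     (\<exists>F. finite F \<and> F \<subseteq> aff_borel L \<kappa> H P \<and>
        aff_borel L \<kappa> H P = lspan (affine L \<kappa>) F + I) \<and>
     I \<subseteq> aff_n_plus L \<kappa> H P"

definition thick ::
    "'g::ab_group_add lie \<Rightarrow> ('g \<Rightarrow> 'g \<Rightarrow> complex) \<Rightarrow> 'g set \<Rightarrow> 'g aff set \<Rightarrow> bool" where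
  "thick L \<kappa> H I \<longleftrightarrow>
     (\<forall>\<alpha>\<in>aff_roots L \<kappa> H. I \<inter> aff_root_space L \<kappa> H \<alpha> \<noteq> {0} \<longrightarrow> aff_root_space L \<kappa> H \<alpha> \<subseteq> I)"

definition combinatorial_ideal ::
    "'g::ab_group_add lie \<Rightarrow> ('g \<Rightarrow> 'g \<Rightarrow> complex) \<Rightarrow> 'g set \<Rightarrow> ('g \<Rightarrow> complex) set
       \<Rightarrow> 'g aff set \<Rightarrow> bool" where
  "combinatorial_ideal L \<kappa> H P I \<longleftrightarrow> strong_ideal L \<kappa> H P I \<and> thick L \<kappa> H I"

definition supp ::
    "'g::ab_group_add lie \<Rightarrow> ('g \<Rightarrow> 'g \<Rightarrow> complex) \<Rightarrow> 'g set \<Rightarrow> 'g aff set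
       \<Rightarrow> ('g aff \<Rightarrow> complex) set" where
  "supp L \<kappa> H I = {\<alpha> \<in> aff_roots L \<kappa> H. aff_root_space L \<kappa> H \<alpha> \<subseteq> I}"

definition basic_ideal ::
    "'g::ab_group_add lie \<Rightarrow> ('g \<Rightarrow> 'g \<Rightarrow> complex) \<Rightarrow> 'g set \<Rightarrow> ('g \<Rightarrow> complex) set
       \<Rightarrow> 'g aff set \<Rightarrow> bool" where
  "basic_ideal L \<kappa> H P I \<longleftrightarrow> combinatorial_ideal L \<kappa> H P I \<and> supp L \<kappa> H I \<inter> D0 H P \<noteq> {}"

primrec up_step ::
    "'g::ab_group_add lie \<Rightarrow> ('g \<Rightarrow> 'g \<Rightarrow> complex) \<Rightarrow> 'g set \<Rightarrow> ('g \<Rightarrow> complex) set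
       \<Rightarrow> ('g aff \<Rightarrow> complex) \<Rightarrow> nat \<Rightarrow> ('g aff \<Rightarrow> complex) set" where
  "up_step L \<kappa> H P \<alpha> 0 = {\<alpha>}"
| "up_step L \<kappa> H P \<alpha> (Suc i) = up_step L \<kappa> H P \<alpha> i \<union>
     {\<gamma> \<in> D0 H P. \<exists>\<xi>\<in>aff_pos_roots L \<kappa> H P. \<exists>\<beta>\<in>up_step L \<kappa> H P \<alpha> i. \<gamma> = \<xi> + \<beta>}"

definition up_set ::
    "'g::ab_group_add lie \<Rightarrow> ('g \<Rightarrow> 'g \<Rightarrow> complex) \<Rightarrow> 'g set \<Rightarrow> ('g \<Rightarrow> complex) set
       \<Rightarrow> ('g aff \<Rightarrow> complex) \<Rightarrow> ('g aff \<Rightarrow> complex) set" where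
  "up_set L \<kappa> H P \<alpha> = (\<Union>i. up_step L \<kappa> H P \<alpha> i)"

definition D_le ::
    "'g::ab_group_add lie \<Rightarrow> ('g \<Rightarrow> 'g \<Rightarrow> complex) \<Rightarrow> 'g set \<Rightarrow> ('g \<Rightarrow> complex) set
       \<Rightarrow> ('g aff \<Rightarrow> complex) \<Rightarrow> ('g aff \<Rightarrow> complex) \<Rightarrow> bool" where
  "D_le L \<kappa> H P \<alpha> \<beta> \<longleftrightarrow> \<beta> \<in> up_set L \<kappa> H P \<alpha>"

definition root_ideal ::
    "'g::ab_group_add lie \<Rightarrow> ('g \<Rightarrow> 'g \<Rightarrow> complex) \<Rightarrow> 'g set \<Rightarrow> ('g \<Rightarrow> complex) set
       \<Rightarrow> ('g aff \<Rightarrow> complex) \<Rightarrow> 'g aff set" where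
  "root_ideal L \<kappa> H P \<alpha> =
     lspan (affine L \<kappa>) (\<Union>\<beta>\<in>up_set L \<kappa> H P \<alpha> \<union> D' H P. aff_root_space L \<kappa> H \<beta>)"

definition antichain_in :: "'a set \<Rightarrow> ('a \<Rightarrow> 'a \<Rightarrow> bool) \<Rightarrow> 'a set \<Rightarrow> bool" where
  "antichain_in X le A \<longleftrightarrow> A \<subseteq> X \<and> (\<forall>a\<in>A. \<forall>b\<in>A. le a b \<longrightarrow> a = b)"

text \<open>Submodules of the quotient \<open>V / I\<close> of two submodules \<open>I \<subseteq> V\<close> of \<open>L\<close>, under the adjoint
  action of the subalgebra \<open>B\<close>. Elements of the quotient are cosets; for cosets \<open>X = x + I\<close> and
  \<open>Y = y + I\<close> the set sums below are the cosets of \<open>x + y\<close>, \<open>a x\<close> and \<open>[z, x]\<close>, and \<open>I\<close> itself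
  is the zero vector.\<close>

definition quotient_submodule ::
    "'v::ab_group_add lie \<Rightarrow> 'v set \<Rightarrow> 'v set \<Rightarrow> 'v set \<Rightarrow> 'v set set \<Rightarrow> bool" where
  "quotient_submodule L B V I N \<longleftrightarrow>
     N \<subseteq> {x +o I | x. x \<in> V} \<and>
     I \<in> N \<and>
     (\<forall>X\<in>N. \<forall>Y\<in>N. X + Y \<in> N) \<and>
     (\<forall>a. \<forall>X\<in>N. scl L a ` X + I \<in> N) \<and>
     (\<forall>z\<in>B. \<forall>X\<in>N. br L z ` X + I \<in> N)"

end

theory Submission
  imports Defs
begin

text \<open>A basic ideal \<open>J\<close> is graded by roots, hence determined by its support. Bracketing a root
  vector of \<open>J\<close> for a real root in \<open>D\<close> with one of complementary weight puts all of \<open>H \<otimes> t\<close> into \<open>J\<close>,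
  and from there every root space of \<open>D'\<close>. Since \<open>[g\<^sub>\<xi>, g\<^sub>\<beta>] \<noteq> 0\<close> whenever \<open>\<xi> + \<beta> \<in> D\<close>, the rest of the
  support is an up-set of \<open>D\<close>, and conversely every nonempty up-set occurs; up-sets of a finite poset
  correspond to antichains. As \<open>H \<otimes> t \<subseteq> J\<close> gives \<open>i(\<delta>) \<subseteq> J\<close>, basic ideals are also the ideals between
  \<open>i(\<delta>)\<close> and the nilradical, that is, the submodules of the quotient.

  The facts on the simple algebra rest on one computation, \<open>highest_weight\<close>, which replaces
  representation theory of \<open>sl\<^sub>2\<close>: if \<open>e\<close> of root \<open>\<alpha>\<close> kills a vector of weight \<open>\<beta>\<close>, then
  \<open>2 \<beta>(t) = m \<alpha>(t)\<close> for \<open>t = [e, f]\<close> and some natural number \<open>m\<close>.\<close>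

section \<open>Subspaces, cosets and weight vectors\<close>

text \<open>Root vectors for two imaginary roots of positive degree commute, so bracketing with
  imaginary root vectors never leads from one imaginary root to another. Every growth step of an
  ideal therefore has to involve a real root: \<delta> is reached from a real root, and k \<delta>
  with k > 1 is reached by a detour through real roots. Inside D this costs nothing, since a sum of
  two imaginary roots has degree at least 2 and lies in D'. Sums of roots are handled on pairs
  (finite part, degree) instead of functionals. The function \<open>level\<close> on these pairs
  tells which \<open>D_k\<close> contains a root; it is superadditive, and this is why D' absorbs
  brackets. A \<open>positive_system\<close> is given only by closure and a choice of sign, without
  simple roots or a height function. That a nonempty sum of positive roots is never zero, on which
  antisymmetry of the order rests, therefore has to come from the \<open>sl_2\<close> computation as
  well.\<close>

context module
begin

text \<open>A linear combination may use several generators from one \<open>S i\<close>. As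
  \<open>S i\<close> is a subspace they merge into a single vector, which leaves one summand per
  index, as the comparison of weights requires.\<close>

lemma span_UN_subspaces:
  assumes sub: "\<And>i. i \<in> I \<Longrightarrow> subspace (S i)" and x: "x \<in> span (\<Union>i\<in>I. S i)"
  shows "\<exists>F v. finite F \<and> F \<subseteq> I \<and> (\<forall>i\<in>F. v i \<in> S i) \<and> x = sum v F"
  using x
proof (induction rule: span_induct_alt)
  case base
    show ?case by (rule exI[of _ "{}"]) auto
next
  case (step c x y)
    then obtain F v i where F: "finite F" "F \<subseteq> I" "\<forall>i\<in>F. v i \<in> S i" "y = sum v F"
      and i: "i \<in> I" "x \<in> S i" by auto
    \<comment> \<open>If \<open>i\<close> already occurs in \<open>F\<close>, the new term is added
      to \<open>v i\<close>; otherwise it opens a new index.\<close>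
    define w where "w = (\<lambda>j. (if j = i then c *s x else 0) + (if j \<in> F then v j else 0))"
    have "sum w (insert i F) = c *s x + sum v F"
      using F(1) unfolding w_def sum.distrib
      by (auto simp: sum.If_cases Int_insert_left insert_absorb Int_absorb1 intro!: arg_cong2[where f="(+)"] sum.cong)
    moreover have "w j \<in> S j" if "j \<in> insert i F" for j
      using that F(2,3) i sub unfolding w_def
      by (auto intro!: subspace_add subspace_scale subspace_0)
    ultimately show ?case using F i by (intro exI[of _ "insert i F"] exI[of _ w]) auto
qed

lemma set_plus_subspaces_eq_span:
  assumes "subspace S" "subspace T"
  shows "S + T = span (S \<union> T)"
proof -
  have "span S = S" "span T = T" using assms by simp_all
  then show ?thesis by (auto simp only: span_Un set_plus_def)
qed

lemma subspace_set_plus: "subspace S \<Longrightarrow> subspace T \<Longrightarrow> subspace (S + T)"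
  by (simp add: set_plus_subspaces_eq_span)

lemma subset_set_plus:
  assumes "subspace S" "subspace T"
  shows "S \<subseteq> S + T" "T \<subseteq> S + T"
  using span_superset[of "S \<union> T"] assms by (auto simp: set_plus_subspaces_eq_span)

lemma set_plus_subset: "S \<subseteq> U \<Longrightarrow> T \<subseteq> U \<Longrightarrow> subspace U \<Longrightarrow> S + T \<subseteq> U"
  by (auto elim!: set_plus_elim intro!: subspace_add)

lemma coset_add:
  assumes "subspace I"
  shows "(x +o I) + (y +o I) = (x + y) +o I"
proof -
  have "I + I = I"
  proof
    show "I + I \<subseteq> I" using assms by (auto simp: set_plus_def subspace_add)
    show "I \<subseteq> I + I" using subspace_0[OF assms] by (force simp: set_plus_def)
  qed
  then show ?thesis by (simp add: set_plus_rearrange)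
qed

text \<open>Explains the summand \<open>+ I\<close> in \<open>quotient_submodule\<close>: the bare
  image of a coset may be smaller than a coset (scaling by 0 leaves one point), and adding
  \<open>I\<close> completes it.\<close>

lemma coset_image:
  assumes I: "subspace I" and g: "\<And>i. i \<in> I \<Longrightarrow> g (x + i) - g x \<in> I"
  shows "g ` (x +o I) + I = g x +o I"
proof
  show "g ` (x +o I) + I \<subseteq> g x +o I"
  proof
    fix z assume "z \<in> g ` (x +o I) + I"
    then obtain i j where ij: "i \<in> I" "j \<in> I" "z = g (x + i) + j"
      by (auto simp: set_plus_def elt_set_plus_def)
    then have "z = g x + (g (x + i) - g x + j)" by simp
    moreover have "g (x + i) - g x + j \<in> I" using g ij I by (intro subspace_add)
    ultimately show "z \<in> g x +o I" unfolding elt_set_plus_def by blast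
  qed
  show "g x +o I \<subseteq> g ` (x +o I) + I"
  proof
    fix z assume "z \<in> g x +o I"
    then obtain i where "i \<in> I" "z = g x + i" by (auto simp: elt_set_plus_def)
    moreover have "x \<in> x +o I" using subspace_0[OF I] by (force simp: elt_set_plus_def)
    ultimately show "z \<in> g ` (x +o I) + I" by (auto simp: set_plus_def)
  qed
qed

lemma coset_self: "subspace I \<Longrightarrow> x \<in> x +o I"
  using subspace_0 by (force simp: elt_set_plus_def)

lemma coset_eqI:
  assumes I: "subspace I" and y: "y \<in> x +o I"
  shows "y +o I = x +o I"
proof -
  obtain i where i: "i \<in> I" "y = x + i" using y by (auto simp: elt_set_plus_def)
  have "z \<in> y +o I \<longleftrightarrow> z \<in> x +o I" for z
  proof -
    have "z - x = (z - y) + i" "z - y = (z - x) - i" using i by auto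
    then have "z - y \<in> I \<longleftrightarrow> z - x \<in> I" using i(1) I by (metis subspace_add subspace_diff)
    moreover have "z \<in> a +o I \<longleftrightarrow> z - a \<in> I" for a
      by (auto simp: elt_set_plus_def intro!: bexI[of _ "z - a"])
    ultimately show ?thesis by simp
  qed
  then show ?thesis by blast
qed

end

lemma (in vector_space) subspace_finite_span:
  assumes "finite T" "S \<subseteq> span T"
  obtains B where "finite B" "B \<subseteq> S" "S \<subseteq> span B"
  using assms independent_span_bound by (metis basis_exists subset_trans)

text \<open>The weight-vector arguments below use bilinearity of the bracket alone. Isolating it
  lets them serve both \<open>L\<close> and the affine algebra, for which only this much is
  established.\<close>

locale bilinear_bracket = vector_space "scl L" for L :: "'v::ab_group_add lie" +
  assumes br_add_right: "br L x (y + z) = br L x y + br L x z"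
    and br_add_left: "br L (x + y) z = br L x z + br L y z"
    and br_scale_right: "br L x (scl L a y) = scl L a (br L x y)"
    and br_scale_left: "br L (scl L a x) y = scl L a (br L x y)"
begin

lemma br_zero_right [simp]: "br L x 0 = 0"
  using br_add_right[of x 0 0] by simp

lemma br_zero_left [simp]: "br L 0 x = 0"
  using br_add_left[of 0 0 x] by simp

lemma br_minus_right: "br L x (- y) = - br L x y"
  using br_add_right[of x y "- y"] by (simp add: eq_neg_iff_add_eq_0 add.commute)

lemma br_sum_right: "br L x (sum f A) = (\<Sum>i\<in>A. br L x (f i))"
  by (induction A rule: infinite_finite_induct) (auto simp: br_add_right)

lemma br_span_closed:
  assumes "x \<in> span A" "y \<in> span B" "subspace W"
    and "\<And>a b. a \<in> A \<Longrightarrow> b \<in> B \<Longrightarrow> br L a b \<in> W"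
  shows "br L x y \<in> W"
proof -
  have *: "br L a y \<in> W" if "a \<in> A" for a
    using assms(2)
  proof (induction rule: span_induct_alt)
    case base
    then show ?case using assms(3) by (simp add: subspace_0)
  next
    case (step c b y)
    then show ?case using assms(3) assms(4)[OF that step(1)]
      by (simp add: br_add_right br_scale_right subspace_add subspace_scale)
  qed
  show ?thesis
    using assms(1)
  proof (induction rule: span_induct_alt)
    case base
    then show ?case using assms(3) by (simp add: subspace_0)
  next
    case (step c a x)
    then show ?case using assms(3) *[OF step(1)]
      by (simp add: br_add_left br_scale_left subspace_add subspace_scale)
  qed
qed

text \<open>Applying \<open>ad h - c j h\<close> to the sum removes the summand \<open>v j\<close> and rescales \<open>v i\<close> by a
  nonzero factor when \<open>h\<close> separates \<open>i\<close> from \<open>j\<close>.\<close>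

lemma weight_components:
  assumes W: "subspace W" "\<And>h x. h \<in> K \<Longrightarrow> x \<in> W \<Longrightarrow> br L h x \<in> W"
    and "finite F"
    and "\<And>i h. i \<in> F \<Longrightarrow> h \<in> K \<Longrightarrow> br L h (v i) = scl L (c i h) (v i)"
    and "\<And>i j. i \<in> F \<Longrightarrow> j \<in> F \<Longrightarrow> i \<noteq> j \<Longrightarrow> \<exists>h\<in>K. c i h \<noteq> c j h"
    and "sum v F \<in> W" and "i \<in> F"
  shows "v i \<in> W"
  using assms(3-)
proof (induction F arbitrary: v i rule: finite_induct)
  case empty
  then show ?case by simp
next
  case (insert j F)
  have *: "v i \<in> W" if i: "i \<in> F" for i
  proof -
    obtain h where h: "h \<in> K" "c i h \<noteq> c j h"
      using insert.prems(2)[of i j] i insert.hyps by auto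
    define w where "w = (\<lambda>l. scl L (c l h - c j h) (v l))"
    have "br L h (sum v (insert j F)) - scl L (c j h) (sum v (insert j F)) =
        (\<Sum>l\<in>insert j F. w l)"
      unfolding w_def br_sum_right scale_sum_right sum_subtractf[symmetric]
      using insert.prems(1)[OF _ h(1)] by (intro sum.cong) (auto simp: scale_left_diff_distrib)
    also have "\<dots> = sum w F" using insert.hyps by (simp add: w_def)
    finally have "sum w F \<in> W"
      using W insert.prems(3) h(1) by (metis subspace_diff subspace_scale)
    moreover have "br L k (w l) = scl L (c l k) (w l)" if "l \<in> F" "k \<in> K" for l k
      using insert.prems(1)[of l k] that unfolding w_def by (simp add: br_scale_right mult.commute)
    ultimately have "w i \<in> W"
      using insert.IH[of w i] insert.prems(2) i by blast
    then have "scl L (inverse (c i h - c j h)) (w i) \<in> W"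
      using W(1) by (rule subspace_scale[rotated])
    then show ?thesis using h(2) by (simp add: w_def)
  qed
  have "sum v F \<in> W" using * W(1) by (simp add: subspace_sum)
  moreover have "v j = sum v (insert j F) - sum v F" using insert.hyps by simp
  ultimately have "v j \<in> W" using W(1) insert.prems(3) by (metis subspace_diff)
  then show ?case using * insert.prems(4) by auto
qed

lemma subspace_root_space [simp]: "subspace (root_space L H \<alpha>)"
  unfolding subspace_def root_space_def
  by (auto simp: br_add_right br_scale_right scale_right_distrib mult.commute)

lemma dual_space_separated:
  assumes "\<alpha> \<in> dual_space L H" "\<beta> \<in> dual_space L H" "\<alpha> \<noteq> \<beta>"
  shows "\<exists>h\<in>H. \<alpha> h \<noteq> \<beta> h"
proof (rule ccontr)
  assume "\<not> ?thesis"
  then have "\<alpha> x = \<beta> x" for x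
    using assms unfolding dual_space_def by (cases "x \<in> H") auto
  then show False using assms(3) by auto
qed

lemma root_space_unique:
  assumes "\<alpha> \<in> dual_space L H" "\<beta> \<in> dual_space L H"
    and "x \<in> root_space L H \<alpha>" "x \<in> root_space L H \<beta>" "x \<noteq> 0"
  shows "\<alpha> = \<beta>"
proof (rule ccontr)
  assume "\<alpha> \<noteq> \<beta>"
  then obtain h where "h \<in> H" "\<alpha> h \<noteq> \<beta> h"
    using dual_space_separated assms(1,2) by blast
  moreover have "scl L (\<alpha> h) x = scl L (\<beta> h) x"
    using assms(3,4) \<open>h \<in> H\<close> unfolding root_space_def by auto
  ultimately show False using assms(5) by simp
qed

lemma root_components:
  assumes "subspace W" "\<And>h x. h \<in> H \<Longrightarrow> x \<in> W \<Longrightarrow> br L h x \<in> W"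
    and "finite F" "F \<subseteq> dual_space L H"
    and "\<And>\<alpha>. \<alpha> \<in> F \<Longrightarrow> v \<alpha> \<in> root_space L H \<alpha>"
    and "sum v F \<in> W" "\<alpha> \<in> F"
  shows "v \<alpha> \<in> W"
proof (rule weight_components[OF assms(1,2,3) _ _ assms(6,7), where c = "\<lambda>\<alpha>. \<alpha>"])
  show "\<exists>h\<in>H. i h \<noteq> j h" if "i \<in> F" "j \<in> F" "i \<noteq> j" for i j
    using that assms(4) by (intro dual_space_separated) auto
qed (use assms(5) in \<open>auto simp: root_space_def\<close>)

lemma root_vectors_independent:
  assumes "finite F" "F \<subseteq> dual_space L H"
    and "\<And>\<alpha>. \<alpha> \<in> F \<Longrightarrow> v \<alpha> \<in> root_space L H \<alpha>"
    and "sum v F = 0" "\<alpha> \<in> F"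
  shows "v \<alpha> = 0"
  using root_components[of "{0}" H F v \<alpha>] assms by (auto simp: subspace_0)

lemma span_root_spaces:
  assumes x: "x \<in> span (\<Union>\<beta>\<in>S. root_space L H \<beta>)"
  obtains F v where "finite F" "F \<subseteq> S" "\<And>\<beta>. \<beta> \<in> F \<Longrightarrow> v \<beta> \<in> root_space L H \<beta>" "x = sum v F"
proof -
  have "\<exists>F v. finite F \<and> F \<subseteq> S \<and> (\<forall>\<beta>\<in>F. v \<beta> \<in> root_space L H \<beta>) \<and> x = sum v F"
    by (rule span_UN_subspaces) (rule subspace_root_space, rule x)
  then show thesis by (elim exE conjE) (rule that, auto)
qed

lemma root_space_meets_span:
  assumes S: "S \<subseteq> dual_space L H" and \<alpha>: "\<alpha> \<in> dual_space L H"
    and x: "x \<in> root_space L H \<alpha>" "x \<in> span (\<Union>\<beta>\<in>S. root_space L H \<beta>)" "x \<noteq> 0"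
  shows "\<alpha> \<in> S"
proof (rule ccontr)
  assume \<alpha>S: "\<alpha> \<notin> S"
  obtain F v where F: "finite F" "F \<subseteq> S" "\<And>\<beta>. \<beta> \<in> F \<Longrightarrow> v \<beta> \<in> root_space L H \<beta>" "x = sum v F"
    by (rule span_root_spaces[OF x(2)]) (rule that)
  define w where "w = v(\<alpha> := - x)"
  have F\<alpha>: "\<alpha> \<notin> F" using F(2) \<alpha>S by auto
  have "sum w F = sum v F" using F\<alpha> by (intro sum.cong) (auto simp: w_def)
  then have "sum w (insert \<alpha> F) = 0" using F(1,4) F\<alpha> by (simp add: w_def)
  moreover have "w \<beta> \<in> root_space L H \<beta>" if "\<beta> \<in> insert \<alpha> F" for \<beta>
    using that F(3) x(1) subspace_neg[OF subspace_root_space x(1)] by (auto simp: w_def)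
  ultimately have "w \<alpha> = 0"
    using root_vectors_independent[of "insert \<alpha> F" H w \<alpha>] F(1,2) S \<alpha> by auto
  then show False using x(3) by (simp add: w_def)
qed

text \<open>This makes ideals graded: they are stable under the Cartan subalgebra, so
  \<open>root_components\<close> keeps each weight component inside.\<close>

lemma root_space_decomposition:
  assumes S: "S \<subseteq> dual_space L H" and J: "subspace J" "\<And>h x. h \<in> H \<Longrightarrow> x \<in> J \<Longrightarrow> br L h x \<in> J"
    and JS: "J \<subseteq> span (\<Union>\<beta>\<in>S. root_space L H \<beta>)"
  shows "J \<subseteq> span (\<Union>\<beta>\<in>S. J \<inter> root_space L H \<beta>)"
proof
  fix x assume x: "x \<in> J"
  have "x \<in> span (\<Union>\<beta>\<in>S. root_space L H \<beta>)" using x JS by auto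
  then obtain F v where F: "finite F" "F \<subseteq> S" "\<And>\<beta>. \<beta> \<in> F \<Longrightarrow> v \<beta> \<in> root_space L H \<beta>"
    "x = sum v F"
    by (rule span_root_spaces) (rule that)
  have "v \<beta> \<in> J" if "\<beta> \<in> F" for \<beta>
    using root_components[OF J F(1), where v = v] F S x that by auto
  then show "x \<in> span (\<Union>\<beta>\<in>S. J \<inter> root_space L H \<beta>)"
    unfolding F(4) using F(2,3) by (intro span_sum span_base) blast
qed

end

sublocale lie_algebra \<subseteq> bilinear_bracket L
proof
  fix x y z a
  note hom = module_hom.add module_hom.scale
  show "br L x (y + z) = br L x y + br L x z" "br L x (scl L a y) = scl L a (br L x y)"
    by (rule hom[OF Vector_Spaces.linear.axioms(3)[OF linear_br_right]])+
  show "br L (x + y) z = br L x z + br L y z" "br L (scl L a x) y = scl L a (br L x y)"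
    by (rule hom[OF Vector_Spaces.linear.axioms(3)[OF linear_br_left]])+
qed

context lie_algebra
begin

lemma br_commute: "br L y x = - br L x y"
proof -
  have "br L x y + br L y x = 0"
    using br_self[of "x + y"] br_self[of x] br_self[of y] by (simp add: br_add_left br_add_right add.commute)
  then show ?thesis by (simp add: eq_neg_iff_add_eq_0 add.commute)
qed

text \<open>The Jacobi identity in the form that \<open>br L x\<close> is a derivation.\<close>

lemma br_br: "br L x (br L y z) = br L (br L x y) z + br L y (br L x z)"
proof -
  have "br L y (br L z x) = - br L y (br L x z)"
    using br_commute[of z x] by (simp add: br_minus_right)
  then show ?thesis
    using jacobi[of x y z] br_commute[of z "br L x y"] by (simp add: algebra_simps)
qed

lemma br_root_space:
  assumes "x \<in> root_space L H \<alpha>" "y \<in> root_space L H \<beta>"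
  shows "br L x y \<in> root_space L H (\<alpha> + \<beta>)"
  using assms unfolding root_space_def
  by (auto simp: br_br[of _ x y] br_scale_left br_scale_right scale_left_distrib)

end

section \<open>Root space decomposition of a simple Lie algebra\<close>

lemma dual_space_0 [simp]: "0 \<in> dual_space L H"
  by (simp add: dual_space_def zero_fun_def)

lemma dual_space_add: "\<alpha> \<in> dual_space L H \<Longrightarrow> \<beta> \<in> dual_space L H \<Longrightarrow> \<alpha> + \<beta> \<in> dual_space L H"
  by (simp add: dual_space_def plus_fun_def algebra_simps)

lemma dual_space_uminus: "\<alpha> \<in> dual_space L H \<Longrightarrow> - \<alpha> \<in> dual_space L H"
  by (simp add: dual_space_def fun_Compl_def)

lemma roots_dual: "\<alpha> \<in> roots L H \<Longrightarrow> \<alpha> \<in> dual_space L H"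
  by (simp add: roots_def)

lemma roots_nonzero: "0 \<notin> roots L H"
  by (simp add: roots_def)

section \<open>Simplicity, the invariant form and the Cartan subalgebra\<close>

locale cartan_decomposition = simple_lie_algebra L for L :: "'v::ab_group_add lie" +
  fixes \<kappa> :: "'v \<Rightarrow> 'v \<Rightarrow> complex" and H :: "'v set"
  assumes finite_dim: "finite_dimensional L"
    and invariant: "invariant_form L \<kappa>"
    and cartan: "cartan_subalgebra L H"
begin

abbreviation "RS \<equiv> root_space L H"
abbreviation "R \<equiv> roots L H"

lemma form_add_right: "\<kappa> x (y + z) = \<kappa> x y + \<kappa> x z"
  and form_scale_right: "\<kappa> x (scl L a y) = a * \<kappa> x y"
proof -
  have lin: "Vector_Spaces.linear (scl L) (*) (\<kappa> x)"
    using invariant by (simp add: invariant_form_def)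
  show "\<kappa> x (y + z) = \<kappa> x y + \<kappa> x z" "\<kappa> x (scl L a y) = a * \<kappa> x y"
    using module_hom.add[OF Vector_Spaces.linear.axioms(3)[OF lin]]
      module_hom.scale[OF Vector_Spaces.linear.axioms(3)[OF lin]] by auto
qed

lemma form_commute: "\<kappa> x y = \<kappa> y x"
  and form_assoc: "\<kappa> (br L x y) z = \<kappa> x (br L y z)"
  and form_nontrivial: "\<exists>x y. \<kappa> x y \<noteq> 0"
  using invariant by (auto simp: invariant_form_def)

lemma form_add_left: "\<kappa> (x + y) z = \<kappa> x z + \<kappa> y z"
  using form_add_right by (metis form_commute)

lemma form_scale_left: "\<kappa> (scl L a x) y = a * \<kappa> x y"
  using form_scale_right by (metis form_commute)

lemma form_zero_right [simp]: "\<kappa> x 0 = 0"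
  using form_add_right[of x 0 0] by simp

lemma form_zero_left [simp]: "\<kappa> 0 x = 0"
  using form_zero_right form_commute by metis

lemma form_minus_right: "\<kappa> x (- y) = - \<kappa> x y"
  using form_add_right[of x y "- y"] by (simp add: eq_neg_iff_add_eq_0 add.commute)

lemma form_minus_left: "\<kappa> (- x) y = - \<kappa> x y"
  using form_minus_right form_commute by metis

lemma subspace_cartan: "subspace H"
  and cartan_commute: "h \<in> H \<Longrightarrow> k \<in> H \<Longrightarrow> br L h k = 0"
  and cartan_self_centralizing: "(\<And>h. h \<in> H \<Longrightarrow> br L h x = 0) \<Longrightarrow> x \<in> H"
  and cartan_diagonalizable: "h \<in> H \<Longrightarrow> span {x. \<exists>c. br L h x = scl L c x} = UNIV"
  using cartan by (auto simp: cartan_subalgebra_def)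

lemma root_space_0: "RS 0 = H"
  using cartan_commute cartan_self_centralizing unfolding root_space_def by auto

lemma cartan_nonzero: "H \<noteq> {0}"
proof
  assume "H = {0}"
  then have "x \<in> H" for x by (intro cartan_self_centralizing) auto
  then show False using non_abelian \<open>H = {0}\<close> by auto
qed

lemma finite_span_UNIV: obtains G where "finite G" "span G = UNIV"
  using finite_dim by (auto simp: finite_dimensional_def)

lemma finite_span_subset: obtains B where "finite B" "B \<subseteq> S" "S \<subseteq> span B"
proof -
  obtain G where "finite G" "span G = UNIV" by (rule finite_span_UNIV)
  then show thesis using subspace_finite_span[of G S] that by auto
qed

text \<open>The center is an ideal, and it is proper because the bracket is not zero.\<close>

lemma center_trivial:
  assumes "\<And>x. br L z x = 0"
  shows "z = 0"
proof -
  define Z where "Z = {z. \<forall>x. br L z x = 0}"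
  have "br L x z = 0" if "z \<in> Z" for x z
    using that br_commute[of x z] by (simp add: Z_def)
  moreover have "subspace Z"
    unfolding subspace_def Z_def by (auto simp: br_add_left br_scale_left)
  ultimately have "lie_ideal L UNIV Z" by (auto simp: lie_ideal_def subspace_0)
  moreover have "Z \<noteq> UNIV" using non_abelian by (auto simp: Z_def)
  ultimately have "Z = {0}" using simple by blast
  then show ?thesis using assms by (auto simp: Z_def)
qed

text \<open>Invariance makes the radical of the form an ideal, and it is proper because the form is
  not zero.\<close>

lemma form_nondegenerate:
  assumes "\<And>y. \<kappa> x y = 0"
  shows "x = 0"
proof -
  define Z where "Z = {x. \<forall>y. \<kappa> x y = 0}"
  have "subspace Z"
    unfolding subspace_def Z_def by (auto simp: form_add_left form_scale_left)
  moreover have "\<kappa> (br L x z) y = 0" if "z \<in> Z" for x y z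
  proof -
    have "\<kappa> (br L x z) y = - \<kappa> (br L z x) y" using br_commute[of z x] by (simp add: form_minus_left)
    then show ?thesis using that by (simp add: form_assoc Z_def)
  qed
  ultimately have "lie_ideal L UNIV Z" by (auto simp: lie_ideal_def Z_def)
  moreover have "Z \<noteq> UNIV" using form_nontrivial by (auto simp: Z_def)
  ultimately have "Z = {0}" using simple by blast
  then show ?thesis using assms by (auto simp: Z_def)
qed

section \<open>Simultaneous diagonalization and the root space decomposition\<close>

lemma span_joint_eigenvectors:
  assumes "finite K" "K \<subseteq> H"
  shows "span {x. \<forall>h\<in>K. \<exists>c. br L h x = scl L c x} = UNIV"
  using assms
proof (induction K rule: finite_induct)
  case empty
  show ?case by simp
next
  case (insert h K)
  let ?E = "\<lambda>K. {x. \<forall>h\<in>K. \<exists>c. br L h x = scl L c x}"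
  have "v \<in> span (?E (insert h K))" if v: "v \<in> ?E K" for v
  proof -
    have "\<forall>k. \<exists>c. k \<in> K \<longrightarrow> br L k v = scl L c v" using v by auto
    then obtain b where b: "\<And>k. k \<in> K \<Longrightarrow> br L k v = scl L (b k) v" by metis
    define W where "W = {x. \<forall>k\<in>K. br L k x = scl L (b k) x}"
    have W: "subspace W"
      unfolding subspace_def W_def
      by (auto simp: br_add_right br_scale_right scale_right_distrib mult.commute)
    \<comment> \<open>Commutativity of \<open>H\<close> makes the joint eigenspace \<open>W\<close>
      of \<open>K\<close> stable under the new element \<open>h\<close>.\<close>
    have hW: "br L h x \<in> W" if "x \<in> W" for x
    proof -
      have "br L k (br L h x) = scl L (b k) (br L h x)" if k: "k \<in> K" for k
        using br_br[of k h x] cartan_commute[of k h] insert.prems k \<open>x \<in> W\<close>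
        by (auto simp: W_def br_scale_right)
      then show ?thesis by (auto simp: W_def)
    qed
    have "{x. \<exists>c. br L h x = scl L c x} = (\<Union>c\<in>UNIV. {x. br L h x = scl L c x})" by auto
    then have "v \<in> span (\<Union>c\<in>UNIV. {x. br L h x = scl L c x})"
      using cartan_diagonalizable[of h] insert.prems by auto
    moreover have "subspace {x. br L h x = scl L c x}" for c
      unfolding subspace_def
      by (auto simp: br_add_right br_scale_right scale_right_distrib mult.commute)
    ultimately have "\<exists>F w. finite F \<and> F \<subseteq> UNIV \<and> (\<forall>c\<in>F. w c \<in> {x. br L h x = scl L c x}) \<and> v = sum w F"
      by (intro span_UN_subspaces)
    then obtain F w where F: "finite F" "\<And>c. c \<in> F \<Longrightarrow> br L h (w c) = scl L c (w c)" "v = sum w F"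
      by auto
    \<comment> \<open>The components of \<open>v\<close> for the distinct eigenvalues of
      \<open>h\<close> stay in the stable space \<open>W\<close>, so they remain joint eigenvectors
      for \<open>K\<close>.\<close>
    have "w c \<in> W" if "c \<in> F" for c
    proof (rule weight_components[OF W, where K = "{h}" and F = F and c = "\<lambda>c _. c"])
      show "sum w F \<in> W" using b F(3) by (auto simp: W_def)
    qed (use hW F that in auto)
    then have "w c \<in> ?E (insert h K)" if "c \<in> F" for c
      using F(2)[OF that] that by (auto simp: W_def)
    then show ?thesis unfolding F(3) by (intro span_sum span_base)
  qed
  then have "span (?E K) \<subseteq> span (?E (insert h K))" by (intro span_minimal) auto
  then show ?case using insert by auto
qed

text \<open>The index 0 accounts for \<open>H\<close>, which \<open>roots\<close> leaves out. A
  joint eigenvector for a finite spanning subset of \<open>H\<close> is one for all of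
  \<open>H\<close>, hence a weight vector.\<close>

lemma root_space_decomposition_UNIV: "span (\<Union>\<alpha>\<in>insert 0 R. RS \<alpha>) = UNIV"
proof -
  obtain B where B: "finite B" "B \<subseteq> H" "H \<subseteq> span B" by (rule finite_span_subset)
  have "v \<in> (\<Union>\<alpha>\<in>insert 0 R. RS \<alpha>)" if v: "\<forall>h\<in>B. \<exists>c. br L h v = scl L c v" for v
  proof (cases "v = 0")
    case True
    then show ?thesis by (auto simp: root_space_def)
  next
    case False
    \<comment> \<open>Being an eigenvector is inherited from \<open>B\<close> to its span because
      the \<open>h\<close> with eigenvector \<open>v\<close> form a subspace.\<close>
    have "subspace {h. \<exists>c. br L h v = scl L c v}"
      unfolding subspace_def
    proof safe
      show "\<exists>c. br L 0 v = scl L c v" by (rule exI[of _ 0]) simp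
      show "\<exists>e. br L (x + y) v = scl L e v" if "br L x v = scl L c v" "br L y v = scl L d v" for x y c d
        using that by (intro exI[of _ "c + d"]) (simp add: br_add_left scale_left_distrib)
      show "\<exists>e. br L (scl L a x) v = scl L e v" if "br L x v = scl L c v" for a x c
        using that by (intro exI[of _ "a * c"]) (simp add: br_scale_left)
    qed
    then have "span B \<subseteq> {h. \<exists>c. br L h v = scl L c v}"
      using v by (intro span_minimal) auto
    then have "\<forall>h. \<exists>c. h \<in> H \<longrightarrow> br L h v = scl L c v" using B(3) by auto
    then obtain a where a: "\<And>h. h \<in> H \<Longrightarrow> br L h v = scl L (a h) v" by metis
    \<comment> \<open>The value 0 outside \<open>H\<close> is the normalization demanded by
      \<open>dual_space\<close>. Linearity on \<open>H\<close> holds because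
      \<open>v \<noteq> 0\<close> determines its eigenvalues.\<close>
    define \<alpha> where "\<alpha> = (\<lambda>h. if h \<in> H then a h else 0)"
    have "\<alpha> \<in> dual_space L H"
      unfolding dual_space_def
    proof safe
      fix x y c assume "x \<in> H"
      then have cx: "scl L c x \<in> H" using subspace_cartan by (simp add: subspace_scale)
      have "scl L (a (scl L c x)) v = scl L (c * a x) v"
        using a[OF cx] a[OF \<open>x \<in> H\<close>] by (metis br_scale_left scale_scale)
      then show "\<alpha> (scl L c x) = c * \<alpha> x" using False cx \<open>x \<in> H\<close> by (simp add: \<alpha>_def)
      assume "y \<in> H"
      with \<open>x \<in> H\<close> have xy: "x + y \<in> H" using subspace_cartan by (simp add: subspace_add)
      have "scl L (a (x + y)) v = scl L (a x + a y) v"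
        using a[OF xy] a[OF \<open>x \<in> H\<close>] a[OF \<open>y \<in> H\<close>] by (simp add: br_add_left scale_left_distrib)
      then show "\<alpha> (x + y) = \<alpha> x + \<alpha> y"
        using False xy \<open>x \<in> H\<close> \<open>y \<in> H\<close> by (simp add: \<alpha>_def)
    qed (simp add: \<alpha>_def)
    moreover have "v \<in> RS \<alpha>" using a by (simp add: root_space_def \<alpha>_def)
    ultimately have "\<alpha> \<in> insert 0 R" using False by (auto simp: roots_def)
    with \<open>v \<in> RS \<alpha>\<close> show ?thesis by blast
  qed
  then have "span {x. \<forall>h\<in>B. \<exists>c. br L h x = scl L c x} \<subseteq> span (\<Union>\<alpha>\<in>insert 0 R. RS \<alpha>)"
    by (intro span_mono) auto
  then show ?thesis using span_joint_eigenvectors[OF B(1,2)] by auto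
qed

lemma root_vector: assumes "\<alpha> \<in> R" obtains x where "x \<in> RS \<alpha>" "x \<noteq> 0"
proof -
  have "0 \<in> RS \<alpha>" by (simp add: root_space_def)
  then show thesis using assms that by (auto simp: roots_def)
qed

lemma in_rootsI: "\<alpha> \<in> dual_space L H \<Longrightarrow> x \<in> RS \<alpha> \<Longrightarrow> x \<noteq> 0 \<Longrightarrow> \<alpha> \<in> insert 0 R"
  by (auto simp: roots_def)

text \<open>Nonzero vectors of distinct weights are independent, so a finite spanning set bounds
  their number.\<close>

lemma finite_roots: "finite R"
proof -
  obtain G where G: "finite G" "span G = UNIV" by (rule finite_span_UNIV)
  have "\<forall>\<alpha>. \<exists>x. \<alpha> \<in> R \<longrightarrow> x \<in> RS \<alpha> \<and> x \<noteq> 0" by (meson root_vector)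
  then obtain v where v: "\<And>\<alpha>. \<alpha> \<in> R \<Longrightarrow> v \<alpha> \<in> RS \<alpha>" "\<And>\<alpha>. \<alpha> \<in> R \<Longrightarrow> v \<alpha> \<noteq> 0" by metis
  have inj: "inj_on v R"
  proof (rule inj_onI)
    fix \<alpha> \<beta> assume "\<alpha> \<in> R" "\<beta> \<in> R" "v \<alpha> = v \<beta>"
    then show "\<alpha> = \<beta>" using v roots_dual by (metis root_space_unique)
  qed
  have "independent (v ` R)"
    unfolding independent_explicit_module
  proof (intro allI impI)
    fix t u w assume t: "finite t" "t \<subseteq> v ` R" "(\<Sum>v\<in>t. scl L (u v) v) = 0" "w \<in> t"
    then obtain F where F: "F \<subseteq> R" "finite F" "t = v ` F" by (meson finite_subset_image)
    then obtain \<alpha> where \<alpha>: "\<alpha> \<in> F" "w = v \<alpha>" using t(4) by auto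
    have 0: "(\<Sum>\<alpha>\<in>F. scl L (u (v \<alpha>)) (v \<alpha>)) = 0"
      using t(3) F inj by (simp add: sum.reindex inj_on_subset)
    have Fd: "F \<subseteq> dual_space L H" using F(1) roots_dual by auto
    have "scl L (u (v \<alpha>)) (v \<alpha>) = 0"
      by (rule root_vectors_independent[OF F(2) Fd _ 0 \<alpha>(1)])
        (use v(1) F(1) in \<open>auto intro!: subspace_scale\<close>)
    then show "u w = 0" using \<alpha> v(2) F(1) by auto
  qed
  then have "finite (v ` R)" using independent_span_bound[OF G(1), of "v ` R"] G(2) by auto
  then show ?thesis using inj by (simp add: finite_image_iff)
qed

section \<open>Duality between opposite root spaces\<close>

lemma form_root_spaces_orthogonal:
  assumes "x \<in> RS \<alpha>" "y \<in> RS \<beta>" "h \<in> H" "\<alpha> h + \<beta> h \<noteq> 0"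
  shows "\<kappa> x y = 0"
proof -
  have "\<alpha> h * \<kappa> x y = \<kappa> (br L h x) y"
    using assms by (simp add: root_space_def form_scale_left)
  also have "\<dots> = - \<kappa> (br L x h) y" using br_commute[of h x] by (simp add: form_minus_left)
  also have "\<dots> = - (\<beta> h * \<kappa> x y)"
    using assms by (simp add: form_assoc root_space_def form_scale_right)
  finally have "(\<alpha> h + \<beta> h) * \<kappa> x y = 0" by (simp add: algebra_simps)
  then show ?thesis using assms(4) by simp
qed

text \<open>Nondegeneracy together with the root space decomposition yields a partner of
  \<open>x\<close> in some root space, and orthogonality leaves only the weight
  \<open>- \<alpha>\<close> for it.\<close>

lemma form_dual_vector:
  assumes \<alpha>: "\<alpha> \<in> insert 0 R" and x: "x \<in> RS \<alpha>" "x \<noteq> 0"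
  obtains y where "y \<in> RS (- \<alpha>)" "\<kappa> x y \<noteq> 0"
proof -
  have "\<exists>\<beta>\<in>insert 0 R. \<exists>y\<in>RS \<beta>. \<kappa> x y \<noteq> 0"
  proof (rule ccontr)
    assume "\<not> ?thesis"
    then have "(\<Union>\<beta>\<in>insert 0 R. RS \<beta>) \<subseteq> {y. \<kappa> x y = 0}" by auto
    moreover have "subspace {y. \<kappa> x y = 0}"
      by (auto simp: subspace_def form_add_right form_scale_right)
    ultimately have "span (\<Union>\<beta>\<in>insert 0 R. RS \<beta>) \<subseteq> {y. \<kappa> x y = 0}" by (rule span_minimal)
    then show False using form_nondegenerate[of x] x(2) root_space_decomposition_UNIV by auto
  qed
  then obtain \<beta> y where \<beta>: "\<beta> \<in> insert 0 R" "y \<in> RS \<beta>" "\<kappa> x y \<noteq> 0" by blast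
  have "\<beta> h = (- \<alpha>) h" if "h \<in> H" for h
    using form_root_spaces_orthogonal[OF x(1) \<beta>(2) that] \<beta>(3) by (auto simp: eq_neg_iff_add_eq_0 add.commute)
  moreover have "\<beta> \<in> dual_space L H" "- \<alpha> \<in> dual_space L H"
    using \<alpha> \<beta>(1) by (auto intro: roots_dual dual_space_uminus)
  ultimately have "\<beta> = - \<alpha>" by (meson dual_space_separated)
  then show thesis using that \<beta> by auto
qed

lemma roots_uminus: "\<alpha> \<in> R \<Longrightarrow> - \<alpha> \<in> R"
proof -
  assume \<alpha>: "\<alpha> \<in> R"
  obtain x where x: "x \<in> RS \<alpha>" "x \<noteq> 0" using \<alpha> by (rule root_vector)
  obtain y where y: "y \<in> RS (- \<alpha>)" "\<kappa> x y \<noteq> 0" using form_dual_vector[OF _ x] \<alpha> by auto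
  have "y \<noteq> 0" using y(2) by auto
  moreover have "- \<alpha> \<noteq> 0" using \<alpha> by (auto simp: roots_def)
  ultimately show "- \<alpha> \<in> R"
    using in_rootsI[OF _ y(1)] dual_space_uminus[OF roots_dual[OF \<alpha>]] by auto
qed

lemma cartan_form_nondegenerate:
  assumes "t \<in> H" "\<And>h. h \<in> H \<Longrightarrow> \<kappa> t h = 0"
  shows "t = 0"
  using form_dual_vector[of 0 t] assms root_space_0 by auto

text \<open>These two facts say that \<open>br L x y\<close> is \<open>\<kappa> x y\<close> times
  the element of \<open>H\<close> representing \<open>\<alpha>\<close> under the form; by
  \<open>cartan_form_nondegenerate\<close> they determine it.\<close>

lemma
  assumes "x \<in> RS \<alpha>" "y \<in> RS (- \<alpha>)"
  shows br_opposite_in_cartan: "br L x y \<in> H"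
    and form_br_opposite: "h \<in> H \<Longrightarrow> \<kappa> (br L x y) h = \<alpha> h * \<kappa> x y"
proof -
  show "br L x y \<in> H" using br_root_space[OF assms] root_space_0 by simp
  assume "h \<in> H"
  then have "br L y h = scl L (\<alpha> h) y"
    using assms(2) br_commute[of y h] by (simp add: root_space_def)
  then show "\<kappa> (br L x y) h = \<alpha> h * \<kappa> x y" by (simp add: form_assoc form_scale_right)
qed

text \<open>Only finitely many weights occur, so a string of weight vectors must terminate.\<close>

lemma weight_string_terminates:
  assumes \<alpha>: "\<alpha> \<in> R" and \<beta>: "\<beta> \<in> dual_space L H"
    and W: "\<And>n::nat. W n \<in> RS (\<lambda>h. \<beta> h + of_nat n * \<alpha> h)"
  shows "\<exists>n. W n = 0"
proof (rule ccontr)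
  assume nz: "\<not> ?thesis"
  define g where "g = (\<lambda>(n::nat) h. \<beta> h + of_nat n * \<alpha> h)"
  have "g n \<in> dual_space L H" for n
    using \<beta> roots_dual[OF \<alpha>] by (auto simp: dual_space_def g_def algebra_simps)
  then have "range g \<subseteq> insert 0 R" using in_rootsI W nz unfolding g_def by blast
  then have "finite (range g)" using finite_roots by (meson finite_insert finite_subset)
  moreover obtain h where "\<alpha> h \<noteq> 0" using \<alpha> by (auto simp: roots_def fun_eq_iff)
  then have "inj g" by (auto simp: inj_def g_def dest!: fun_cong[of _ _ h])
  ultimately show False by (simp add: finite_image_iff)
qed

text \<open>With \<open>V n = (ad f)\<^sup>n v\<close> one has
  \<open>[e, V n] = (n \<beta>(t) - n (n - 1) / 2 \<alpha>(t)) V (n - 1)\<close>; the coefficient vanishes at the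
  first \<open>n\<close> with \<open>V n = 0\<close>.\<close>

lemma highest_weight:
  assumes \<alpha>: "\<alpha> \<in> R" and e: "e \<in> RS \<alpha>" and f: "f \<in> RS (- \<alpha>)"
    and \<beta>: "\<beta> \<in> dual_space L H" and v: "v \<in> RS \<beta>" "v \<noteq> 0" "br L e v = 0"
  shows "\<exists>m::nat. 2 * \<beta> (br L e f) = of_nat m * \<alpha> (br L e f)"
proof -
  define t where "t = br L e f"
  have t: "t \<in> H" using br_opposite_in_cartan[OF e f] by (simp add: t_def)
  define V where "V = (\<lambda>n. (br L f ^^ n) v)"
  have V: "V n \<in> RS (\<lambda>h. \<beta> h + of_nat n * (- \<alpha>) h)" for n
  proof (induction n)
    case 0
    then show ?case using v by (simp add: V_def)
  next
    case (Suc n)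
    have "(- \<alpha>) + (\<lambda>h. \<beta> h + of_nat n * (- \<alpha>) h) = (\<lambda>h. \<beta> h + of_nat (Suc n) * (- \<alpha>) h)"
      by (auto simp: fun_eq_iff algebra_simps)
    then show ?case using br_root_space[OF f Suc] by (simp add: V_def)
  qed
  \<comment> \<open>The sum of the eigenvalues \<open>\<beta> t - j * \<alpha> t\<close> of
    \<open>t\<close> on \<open>V j\<close> for j < n: each further application of \<open>f\<close>
    contributes one commutator \<open>br L e f = t\<close>.\<close>
  define d where "d = (\<lambda>n::nat. of_nat n * \<beta> t - of_nat n * (of_nat n - 1) / 2 * \<alpha> t)"
  have eV: "br L e (V (Suc n)) = scl L (d (Suc n)) (V n)" for n
  proof (induction n)
    case 0
    have "br L e (br L f v) = br L t v"
      using br_br[of e f v] v(3) by (simp add: t_def)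
    then show ?case using v(1) t by (simp add: V_def d_def root_space_def)
  next
    case (Suc n)
    have "br L e (V (Suc (Suc n))) = br L t (V (Suc n)) + br L f (br L e (V (Suc n)))"
      using br_br[of e f "V (Suc n)"] by (simp add: V_def t_def)
    also have "br L t (V (Suc n)) = scl L (\<beta> t - of_nat (Suc n) * \<alpha> t) (V (Suc n))"
      using V[of "Suc n"] t by (simp add: root_space_def)
    also have "br L f (br L e (V (Suc n))) = scl L (d (Suc n)) (V (Suc n))"
      unfolding Suc by (simp add: V_def br_scale_right)
    also have "scl L (\<beta> t - of_nat (Suc n) * \<alpha> t) (V (Suc n)) + scl L (d (Suc n)) (V (Suc n)) =
        scl L (d (Suc (Suc n))) (V (Suc n))"
      unfolding scale_left_distrib[symmetric] by (simp add: d_def field_simps)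
    finally show ?case .
  qed
  have "\<exists>n. V n = 0"
    by (rule weight_string_terminates[OF roots_uminus[OF \<alpha>] \<beta> V])
  then have LV: "V (LEAST n. V n = 0) = 0" by (rule LeastI_ex)
  moreover have "V 0 \<noteq> 0" using v by (simp add: V_def)
  ultimately obtain n where n: "(LEAST n. V n = 0) = Suc n" by (metis not0_implies_Suc)
  have "V n \<noteq> 0" using n not_less_Least[of n "\<lambda>n. V n = 0"] by simp
  then have "d (Suc n) = 0" using eV[of n] LV n by simp
  \<comment> \<open>Dividing by the nonzero factor \<open>Suc n\<close> leaves the claim, with
    \<open>n\<close> the index of the last nonzero vector of the string as the wanted natural
    number.\<close>
  moreover have "2 * d (Suc n) = of_nat (Suc n) * (2 * \<beta> t - of_nat n * \<alpha> t)"
    by (simp add: d_def algebra_simps)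
  ultimately have "2 * \<beta> t = of_nat n * \<alpha> t"
    by (metis eq_iff_diff_eq_0 mult_eq_0_iff mult_zero_right of_nat_neq_0)
  then show ?thesis by (auto simp: t_def)
qed

text \<open>If \<open>\<alpha>\<close> vanished on \<open>t = br L e f\<close>, then
  \<open>highest_weight\<close>, applied at the upper end of the \<open>\<alpha>\<close>-string
  through any root, would make that root vanish on \<open>t\<close> too. Then \<open>t\<close> would
  be central, hence 0, although it represents a nonzero multiple of \<open>\<alpha>\<close>.\<close>

lemma root_coroot_nonzero:
  assumes \<alpha>: "\<alpha> \<in> R" and e: "e \<in> RS \<alpha>" and f: "f \<in> RS (- \<alpha>)" and ef: "\<kappa> e f \<noteq> 0"
  shows "\<alpha> (br L e f) \<noteq> 0"
proof
  assume 0: "\<alpha> (br L e f) = 0"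
  define t where "t = br L e f"
  have t: "t \<in> H" using br_opposite_in_cartan[OF e f] by (simp add: t_def)
  have \<beta>t: "\<beta> t = 0" if \<beta>: "\<beta> \<in> R" for \<beta>
  proof -
    obtain v where v: "v \<in> RS \<beta>" "v \<noteq> 0" using \<beta> by (rule root_vector)
    \<comment> \<open>Climbing with \<open>e\<close> until the string breaks off produces the vector
      killed by \<open>e\<close> that \<open>highest_weight\<close> asks for.\<close>
    define V where "V = (\<lambda>n. (br L e ^^ n) v)"
    have V: "V n \<in> RS (\<lambda>h. \<beta> h + of_nat n * \<alpha> h)" for n
    proof (induction n)
      case 0
      then show ?case using v by (simp add: V_def)
    next
      case (Suc n)
      have "\<alpha> + (\<lambda>h. \<beta> h + of_nat n * \<alpha> h) = (\<lambda>h. \<beta> h + of_nat (Suc n) * \<alpha> h)"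
        by (auto simp: fun_eq_iff algebra_simps)
      then show ?case using br_root_space[OF e Suc] by (simp add: V_def)
    qed
    have "\<exists>n. V n = 0" by (rule weight_string_terminates[OF \<alpha> roots_dual[OF \<beta>] V])
    then have LV: "V (LEAST n. V n = 0) = 0" by (rule LeastI_ex)
    moreover have "V 0 \<noteq> 0" using v by (simp add: V_def)
    ultimately obtain n where n: "(LEAST n. V n = 0) = Suc n" by (metis not0_implies_Suc)
    have Vn: "V n \<noteq> 0" using n not_less_Least[of n "\<lambda>n. V n = 0"] by simp
    have "br L e (V n) = 0" using LV n by (simp add: V_def)
    moreover have "(\<lambda>h. \<beta> h + of_nat n * \<alpha> h) \<in> dual_space L H"
      using roots_dual[OF \<beta>] roots_dual[OF \<alpha>] by (auto simp: dual_space_def algebra_simps)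
    ultimately obtain m :: nat where "2 * (\<beta> t + of_nat n * \<alpha> t) = of_nat m * \<alpha> t"
      using highest_weight[OF \<alpha> e f _ V Vn] unfolding t_def by blast
    then show ?thesis using 0 by (simp add: t_def)
  qed
  have "br L t x = 0" if "x \<in> (\<Union>\<alpha>\<in>insert 0 R. RS \<alpha>)" for x
    using that \<beta>t t by (auto simp: root_space_def)
  moreover have "subspace {x. br L t x = 0}"
    by (auto simp: subspace_def br_add_right br_scale_right)
  ultimately have "span (\<Union>\<alpha>\<in>insert 0 R. RS \<alpha>) \<subseteq> {x. br L t x = 0}"
    by (intro span_minimal) blast+
  then have "t = 0" using root_space_decomposition_UNIV using center_trivial[of t] by auto
  moreover have "\<exists>h\<in>H. \<alpha> h \<noteq> 0"
    using \<alpha> dual_space_separated[of \<alpha> H 0] by (auto simp: roots_def)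
  ultimately show False using form_br_opposite[OF e f] ef by (auto simp: t_def)
qed

text \<open>After rescaling, \<open>e\<close>, \<open>f\<close> and \<open>br L e f\<close> form an
  \<open>sl_2\<close> triple.\<close>

lemma root_triple:
  assumes \<alpha>: "\<alpha> \<in> R" and e: "e \<in> RS \<alpha>" "e \<noteq> 0"
  obtains f where "f \<in> RS (- \<alpha>)" "\<kappa> e f \<noteq> 0" "\<alpha> (br L e f) \<noteq> 0"
proof -
  obtain f where "f \<in> RS (- \<alpha>)" "\<kappa> e f \<noteq> 0" using form_dual_vector[OF _ e] \<alpha> by auto
  then show thesis using that root_coroot_nonzero[OF \<alpha> e(1)] by auto
qed

lemma root_br_opposite_nonzero:
  assumes "\<alpha> \<in> R"
  obtains x y where "x \<in> RS \<alpha>" "y \<in> RS (- \<alpha>)" "br L x y \<noteq> 0"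
proof -
  obtain e where e: "e \<in> RS \<alpha>" "e \<noteq> 0" using assms by (rule root_vector)
  obtain f where f: "f \<in> RS (- \<alpha>)" "\<alpha> (br L e f) \<noteq> 0" using root_triple[OF assms e] by blast
  have "\<alpha> 0 = 0"
    using assms subspace_cartan subspace_0 unfolding roots_def dual_space_def by force
  then have "br L e f \<noteq> 0" using f by auto
  then show thesis using that e f by auto
qed

text \<open>If \<open>e\<close> kills \<open>RS \<beta>\<close>, then \<open>\<beta>(t)\<close> is a nonnegative multiple of \<open>\<alpha>(t)\<close>; on the other hand
  \<open>e\<close> then also kills \<open>RS (- \<alpha> - \<beta>)\<close> by duality, which gives the opposite sign.\<close>

lemma root_br_nonzero:
  assumes \<alpha>: "\<alpha> \<in> R" and \<beta>: "\<beta> \<in> R" and \<alpha>\<beta>: "\<alpha> + \<beta> \<in> R"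
  obtains x y where "x \<in> RS \<alpha>" "y \<in> RS \<beta>" "br L x y \<noteq> 0"
proof -
  obtain e where e: "e \<in> RS \<alpha>" "e \<noteq> 0" using \<alpha> by (rule root_vector)
  obtain f where f: "f \<in> RS (- \<alpha>)" "\<alpha> (br L e f) \<noteq> 0" using root_triple[OF \<alpha> e] by blast
  obtain v where v: "v \<in> RS \<beta>" "v \<noteq> 0" using \<beta> by (rule root_vector)
  have m: "- (\<alpha> + \<beta>) \<in> R" using \<alpha>\<beta> by (rule roots_uminus)
  obtain u where u: "u \<in> RS (- (\<alpha> + \<beta>))" "u \<noteq> 0" using m by (rule root_vector)
  have "\<exists>y\<in>RS \<beta>. br L e y \<noteq> 0"
  proof (rule ccontr)
    assume "\<not> ?thesis"
    then have z: "br L e y = 0" if "y \<in> RS \<beta>" for y using that by blast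
    obtain k where k: "2 * \<beta> (br L e f) = of_nat k * \<alpha> (br L e f)"
      using highest_weight[OF \<alpha> e(1) f(1) roots_dual[OF \<beta>] v z[OF v(1)]] by blast
    have "br L e u = 0"
    proof (rule ccontr)
      assume nz: "br L e u \<noteq> 0"
      have "br L e u \<in> RS (\<alpha> + - (\<alpha> + \<beta>))" by (rule br_root_space[OF e(1) u(1)])
      then have "br L e u \<in> RS (- \<beta>)" by simp
      then obtain y where y: "y \<in> RS (- (- \<beta>))" "\<kappa> (br L e u) y \<noteq> 0"
        using form_dual_vector[OF _ _ nz] roots_uminus[OF \<beta>] by blast
      have "\<kappa> (br L e u) y = - \<kappa> u (br L e y)"
        using br_commute[of e u] by (simp add: form_minus_left form_assoc)
      then show False using y z by simp
    qed
    then obtain l where l: "2 * (- (\<alpha> + \<beta>)) (br L e f) = of_nat l * \<alpha> (br L e f)"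
      using highest_weight[OF \<alpha> e(1) f(1) roots_dual[OF m] u] by blast
    \<comment> \<open>The three weights add up to zero, while \<open>highest_weight\<close> makes
      the first two nonnegative multiples of \<open>\<alpha> (br L e f)\<close>; the summand 2
      produces the contradiction.\<close>
    have "of_nat (k + l + 2) * \<alpha> (br L e f) =
        2 * \<beta> (br L e f) + 2 * (- (\<alpha> + \<beta>)) (br L e f) + 2 * \<alpha> (br L e f)"
      unfolding k l by (simp add: algebra_simps)
    also have "\<dots> = 0" by (simp add: algebra_simps)
    finally have "of_nat (k + l + 2) * \<alpha> (br L e f) = 0" .
    then show False using f(2) by (metis add_eq_0_iff_both_eq_0 mult_eq_0_iff of_nat_eq_0_iff zero_neq_numeral)
  qed
  then show thesis using that e(1) by blast
qed

text \<open>Subtracting a multiple of \<open>e\<close> from \<open>y\<close> gives \<open>z\<close>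
  orthogonal to \<open>f\<close>. Then \<open>br L z f\<close> lies in \<open>H\<close> and is
  orthogonal to \<open>H\<close>, so \<open>f\<close> kills \<open>z\<close>. A nonzero
  \<open>z\<close> of weight \<open>\<alpha>\<close> killed by a vector of root
  \<open>- \<alpha>\<close> has the wrong sign for \<open>highest_weight\<close>.\<close>

lemma root_space_one_dimensional:
  assumes \<alpha>: "\<alpha> \<in> R" and e: "e \<in> RS \<alpha>" "e \<noteq> 0" and y: "y \<in> RS \<alpha>"
  shows "\<exists>c. y = scl L c e"
proof -
  obtain f where f: "f \<in> RS (- \<alpha>)" "\<kappa> e f \<noteq> 0" "\<alpha> (br L e f) \<noteq> 0"
    using root_triple[OF \<alpha> e] by blast
  define z where "z = y + scl L (- (\<kappa> y f / \<kappa> e f)) e"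
  have z: "z \<in> RS \<alpha>" unfolding z_def using y e(1) by (intro subspace_add subspace_scale) auto
  have zf: "\<kappa> z f = 0" unfolding z_def using f(2) by (simp only: form_add_left form_scale_left) simp
  have "br L z f = 0"
    using form_br_opposite[OF z f(1)] zf br_opposite_in_cartan[OF z f(1)]
    by (intro cartan_form_nondegenerate) auto
  then have fz: "br L f z = 0" using br_commute[of f z] by simp
  have "z = 0"
  proof (rule ccontr)
    assume "z \<noteq> 0"
    moreover have "e \<in> RS (- (- \<alpha>))" using e(1) by simp
    ultimately obtain m :: nat where
      "2 * \<alpha> (br L f e) = of_nat m * (- \<alpha>) (br L f e)"
      using highest_weight[OF roots_uminus[OF \<alpha>] f(1) _ roots_dual[OF \<alpha>] z _ fz] by blast
    then have "of_nat (m + 2) * \<alpha> (br L f e) = 0" by (simp add: algebra_simps)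
    then have "\<alpha> (br L f e) = 0"
      by (metis add_eq_0_iff_both_eq_0 mult_eq_0_iff of_nat_eq_0_iff zero_neq_numeral)
    \<comment> \<open>Functionals in \<open>dual_space\<close> are linear on \<open>H\<close> only,
      so membership in \<open>H\<close> comes before pulling out the sign.\<close>
    moreover have "\<alpha> (br L e f) = - 1 * \<alpha> (br L f e)"
    proof -
      have "br L f e \<in> H" using br_opposite_in_cartan[OF f(1), of e] e(1) by simp
      then have "\<alpha> (scl L (- 1) (br L f e)) = - 1 * \<alpha> (br L f e)"
        using roots_dual[OF \<alpha>] unfolding dual_space_def by blast
      then show ?thesis using br_commute[of e f] by simp
    qed
    ultimately show False using f(3) by simp
  qed
  then have "y = scl L (\<kappa> y f / \<kappa> e f) e" by (simp add: z_def)
  then show ?thesis ..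
qed

text \<open>Without roots \<open>L\<close> would equal \<open>H\<close> and be abelian. The root
  obtained here later serves to reach k \<delta> for k > 1.\<close>

lemma roots_nonempty: "R \<noteq> {}"
proof
  assume "R = {}"
  then have "span H = UNIV" using root_space_decomposition_UNIV by (simp add: root_space_0)
  then have "H = UNIV" using span_minimal[OF order_refl subspace_cartan] by auto
  then show False using non_abelian cartan_commute by auto
qed

end

section \<open>Positive systems\<close>

locale positive_roots = cartan_decomposition L \<kappa> H
  for L :: "'v::ab_group_add lie" and \<kappa> H +
  fixes P :: "('v \<Rightarrow> complex) set"
  assumes positive: "positive_system L H P"
begin

lemma positive_root: "\<alpha> \<in> P \<Longrightarrow> \<alpha> \<in> R"
  and positive_uminus: "\<alpha> \<in> R \<Longrightarrow> \<alpha> \<in> P \<longleftrightarrow> - \<alpha> \<notin> P"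
  and positive_add: "\<alpha> \<in> P \<Longrightarrow> \<beta> \<in> P \<Longrightarrow> \<alpha> + \<beta> \<in> R \<Longrightarrow> \<alpha> + \<beta> \<in> P"
  using positive by (auto simp: positive_system_def)

lemma zero_not_positive: "0 \<notin> P"
  using positive_root roots_nonzero by blast

text \<open>A shortest vanishing sum \<open>\<alpha> + \<beta>\<^sub>2 + \<dots>\<close> has no \<open>\<alpha> + \<beta>\<^sub>i\<close> among the roots, so every \<open>\<beta>\<^sub>i\<close> is
  nonnegative on the coroot of \<open>\<alpha>\<close>, while \<open>\<alpha>\<close> itself is positive on it.\<close>

lemma sum_positive_nonzero:
  assumes "set xs \<subseteq> P" "xs \<noteq> []"
  shows "sum_list xs \<noteq> 0"
  using assms
proof (induction "length xs" arbitrary: xs rule: less_induct)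
  case less
  then obtain \<alpha> ys where xs: "xs = \<alpha> # ys" by (cases xs) auto
  have \<alpha>: "\<alpha> \<in> P" "\<alpha> \<in> R" using less.prems xs positive_root by auto
  show ?case
  proof (cases "\<exists>\<beta>\<in>set ys. \<alpha> + \<beta> \<in> R")
    case True
    then obtain \<beta> where \<beta>: "\<beta> \<in> set ys" "\<alpha> + \<beta> \<in> R" by auto
    let ?zs = "(\<alpha> + \<beta>) # remove1 \<beta> ys"
    have "sum_list ys = \<beta> + sum_list (remove1 \<beta> ys)"
      using sum_list_map_remove1[OF \<beta>(1), of "\<lambda>x. x"] by simp
    then have "sum_list ?zs = sum_list xs" unfolding xs by (simp only: sum_list.Cons add.assoc)
    moreover have "length ?zs < length xs" using \<beta>(1) xs length_pos_if_in_set[OF \<beta>(1)] by (simp add: length_remove1)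
    moreover have "set ?zs \<subseteq> P"
      using less.prems \<beta> xs positive_add set_remove1_subset[of \<beta> ys] by auto
    ultimately show ?thesis using less.hyps[of ?zs] by (metis list.distinct(1))
  next
    case False
    obtain e where e: "e \<in> RS \<alpha>" "e \<noteq> 0" using \<alpha>(2) by (rule root_vector)
    obtain f where f: "f \<in> RS (- \<alpha>)" "\<alpha> (br L e f) \<noteq> 0" using root_triple[OF \<alpha>(2) e] by blast
    define t where "t = br L e f"
    have "\<exists>m::nat. 2 * \<beta> t = of_nat m * \<alpha> t" if \<beta>: "\<beta> \<in> set ys" for \<beta>
    proof -
      have \<beta>P: "\<beta> \<in> P" "\<beta> \<in> R" using \<beta> less.prems xs positive_root by auto
      obtain v where v: "v \<in> RS \<beta>" "v \<noteq> 0" using \<beta>P(2) by (rule root_vector)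
      \<comment> \<open>A nonzero \<open>br L e v\<close> would have weight in
        \<open>insert 0 R\<close>. The case assumption excludes roots, so weight 0 must be excluded
        separately.\<close>
      have "\<alpha> + \<beta> \<noteq> 0"
      proof
        assume "\<alpha> + \<beta> = 0"
        then have "\<beta> = - \<alpha>" by (simp add: eq_neg_iff_add_eq_0 add.commute)
        then show False using positive_uminus[OF \<alpha>(2)] \<alpha>(1) \<beta>P(1) by simp
      qed
      then have "br L e v = 0"
        using False \<beta> in_rootsI[OF dual_space_add br_root_space[OF e(1) v(1)]]
          roots_dual[OF \<alpha>(2)] roots_dual[OF \<beta>P(2)] by auto
      then show ?thesis
        using highest_weight[OF \<alpha>(2) e(1) f(1) roots_dual[OF \<beta>P(2)] v] by (simp add: t_def)
    qed
    then have "\<exists>m::nat. 2 * sum_list ys t = of_nat m * \<alpha> t"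
    proof (induction ys)
      case Nil
      show ?case by (rule exI[of _ 0]) simp
    next
      case (Cons \<beta> ys)
      obtain m where "2 * \<beta> t = of_nat m * \<alpha> t" using Cons.prems by auto
      moreover obtain l where "2 * sum_list ys t = of_nat l * \<alpha> t" using Cons by auto
      ultimately show ?case by (intro exI[of _ "m + l"]) (simp add: algebra_simps)
    qed
    then obtain m where m: "2 * sum_list ys t = of_nat m * \<alpha> t" by blast
    show ?thesis
    proof
      assume "sum_list xs = 0"
      then have "(\<alpha> + sum_list ys) t = 0 t" by (simp add: xs)
      then have "\<alpha> t + sum_list ys t = 0" by simp
      then have "sum_list ys t = - \<alpha> t" by (simp add: eq_neg_iff_add_eq_0 add.commute)
      then have "of_nat (m + 2) * \<alpha> t = 0"
        using m by (simp add: algebra_simps) (simp flip: m)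
      moreover have "of_nat (m + 2) \<noteq> (0 :: complex)" by (simp only: of_nat_eq_0_iff)
      ultimately show False using f(2) unfolding t_def mult_eq_0_iff by blast
    qed
  qed
qed

end

section \<open>Roots of the affine Lie algebra\<close>

context cartan_decomposition
begin

abbreviation "A \<equiv> affine L \<kappa>"

lemma lookup_map_scl [simp]:
  "Poly_Mapping.lookup (Poly_Mapping.map (scl L a) p) k = scl L a (Poly_Mapping.lookup p k)"
  by (simp add: Poly_Mapping.map.rep_eq when_def)

lemma scl_affine: "scl A a z = (Poly_Mapping.map (scl L a) (fst z), a * fst (snd z), a * snd (snd z))"
  by (simp add: affine_def case_prod_beta)

lemma vector_space_affine: "vector_space (scl A)"
proof
  fix a b and x y :: "'v aff"
  show "scl A a (x + y) = scl A a x + scl A a y"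
    by (auto simp: scl_affine prod_eq_iff lookup_add scale_right_distrib algebra_simps
        intro!: poly_mapping_eqI)
  show "scl A (a + b) x = scl A a x + scl A b x"
    by (auto simp: scl_affine prod_eq_iff lookup_add scale_left_distrib algebra_simps
        intro!: poly_mapping_eqI)
  show "scl A a (scl A b x) = scl A (a * b) x" "scl A 1 x = x"
    by (auto simp: scl_affine prod_eq_iff intro!: poly_mapping_eqI)
qed

text \<open>Summing over an arbitrary finite superset of the support allows brackets of different
  elements to be compared over one common index set.\<close>

lemma lookup_loop_br:
  assumes "finite K" "Poly_Mapping.keys p \<subseteq> K"
  shows "Poly_Mapping.lookup (loop_br L p q) n =
    (\<Sum>k\<in>K. br L (Poly_Mapping.lookup p k) (Poly_Mapping.lookup q (n - k)))"
proof -
  have "(\<Sum>l\<in>Poly_Mapping.keys q. Poly_Mapping.lookup (Poly_Mapping.single (k + l)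
      (br L (Poly_Mapping.lookup p k) (Poly_Mapping.lookup q l))) n) =
      br L (Poly_Mapping.lookup p k) (Poly_Mapping.lookup q (n - k))" (is "?l = ?r") for k
  proof -
    have "?l = (\<Sum>l\<in>Poly_Mapping.keys q. if l = n - k then ?r else 0)"
      by (intro sum.cong) (auto simp: lookup_single when_def)
    also have "\<dots> = ?r" by (auto simp: in_keys_iff)
    finally show ?thesis .
  qed
  then have "Poly_Mapping.lookup (loop_br L p q) n =
      (\<Sum>k\<in>Poly_Mapping.keys p. br L (Poly_Mapping.lookup p k) (Poly_Mapping.lookup q (n - k)))"
    by (simp add: loop_br_def lookup_sum)
  also have "\<dots> = (\<Sum>k\<in>K. br L (Poly_Mapping.lookup p k) (Poly_Mapping.lookup q (n - k)))"
    using assms by (intro sum.mono_neutral_left) (auto simp: in_keys_iff)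
  finally show ?thesis .
qed

lemma loop_cocycle_eq:
  assumes "finite K" "Poly_Mapping.keys p \<subseteq> K"
  shows "loop_cocycle \<kappa> p q =
    (\<Sum>k\<in>K. of_int k * \<kappa> (Poly_Mapping.lookup p k) (Poly_Mapping.lookup q (- k)))"
  unfolding loop_cocycle_def using assms by (intro sum.mono_neutral_left) (auto simp: in_keys_iff)

lemma lookup_loop_deriv: "Poly_Mapping.lookup (loop_deriv L p) n = scl L (of_int n) (Poly_Mapping.lookup p n)"
proof -
  have "Poly_Mapping.lookup (loop_deriv L p) n = (\<Sum>k\<in>Poly_Mapping.keys p.
      if k = n then scl L (of_int n) (Poly_Mapping.lookup p n) else 0)"
    unfolding loop_deriv_def lookup_sum
    by (intro sum.cong) (auto simp: lookup_single when_def)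
  then show ?thesis by (auto simp: in_keys_iff)
qed

lemma br_affine:
  assumes K: "finite K" "Poly_Mapping.keys p \<subseteq> K"
  shows "Poly_Mapping.lookup (fst (br A (p, u, v) (q, u', v'))) n =
      (\<Sum>k\<in>K. br L (Poly_Mapping.lookup p k) (Poly_Mapping.lookup q (n - k)))
      + scl L (v * of_int n) (Poly_Mapping.lookup q n) - scl L (v' * of_int n) (Poly_Mapping.lookup p n)"
    and "snd (br A (p, u, v) (q, u', v')) =
      (\<Sum>k\<in>K. of_int k * \<kappa> (Poly_Mapping.lookup p k) (Poly_Mapping.lookup q (- k)), 0)"
  by (auto simp: affine_def lookup_add lookup_minus lookup_loop_deriv
      lookup_loop_br[OF K] loop_cocycle_eq[OF K])

sublocale aff: bilinear_bracket "affine L \<kappa>"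
proof (intro bilinear_bracket.intro bilinear_bracket_axioms.intro vector_space_affine)
  fix x y z :: "'v aff" and a :: complex
  obtain p u v q u' v' r u'' v'' where xyz: "x = (p, u, v)" "y = (q, u', v')" "z = (r, u'', v'')"
    by (cases x; cases y; cases z)
  \<comment> \<open>Contains the supports of \<open>p\<close>, \<open>q\<close>,
    \<open>p + q\<close> and the multiples of \<open>p\<close>, so all bracket formulas below run
    over the same indices.\<close>
  define K where "K = Poly_Mapping.keys p \<union> Poly_Mapping.keys q"
  have K: "finite K" "Poly_Mapping.keys p \<subseteq> K" "Poly_Mapping.keys q \<subseteq> K"
    "Poly_Mapping.keys (p + q) \<subseteq> K" "Poly_Mapping.keys (Poly_Mapping.map (scl L a) p) \<subseteq> K"
    using Poly_Mapping.keys_add[of p q] by (auto simp: K_def in_keys_iff)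
  note br = br_affine[OF K(1,2)] br_affine[OF K(1,3)] br_affine[OF K(1,4)] br_affine[OF K(1,5)]
  note eq = prod_eqI[OF poly_mapping_eqI]
  show "br A x (y + z) = br A x y + br A x z"
    by (rule eq) (auto simp: xyz br lookup_add br_add_right sum.distrib form_add_right algebra_simps
        scale_right_distrib scale_left_distrib)
  show "br A (x + y) z = br A x z + br A y z"
    by (rule eq) (auto simp: xyz br lookup_add br_add_left sum.distrib form_add_left algebra_simps
        scale_right_distrib scale_left_distrib)
  show "br A x (scl A a y) = scl A a (br A x y)"
    by (rule eq) (auto simp: xyz br scl_affine br_scale_right form_scale_right sum_distrib_left
        scale_sum_right scale_right_distrib scale_right_diff_distrib algebra_simps)
  show "br A (scl A a x) y = scl A a (br A x y)"
    by (rule eq) (auto simp: xyz br scl_affine br_scale_left form_scale_left sum_distrib_left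
        scale_sum_right scale_right_distrib scale_right_diff_distrib algebra_simps)
qed

lemmas br_tens = affine_bracket(1)[OF invariant]

lemma tens_add: "tens (x + y) k = tens x k + tens y k"
  by (simp add: tens_def single_add)

lemma tens_scl: "tens (scl L a x) k = scl A a (tens x k)"
  by (auto simp: tens_def scl_affine lookup_single when_def intro!: poly_mapping_eqI)

lemma tens_0 [simp]: "tens 0 k = 0"
  by (simp add: tens_def zero_prod_def)

lemma tens_eq_iff [simp]: "tens x k = tens y k \<longleftrightarrow> x = y"
  by (metis tens_def fst_conv lookup_single_eq)

lemma tens_eq_0_iff [simp]: "tens x k = 0 \<longleftrightarrow> x = 0"
  using tens_eq_iff[of x k 0] by (simp del: tens_eq_iff)

lemma tens_span:
  assumes "x \<in> span S"
  shows "tens x k \<in> aff.span ((\<lambda>x. tens x k) ` S)"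
  using assms
proof (induction rule: span_induct_alt)
  case base
  show ?case by (simp add: aff.span_zero)
next
  case (step c x y)
  then show ?case by (simp add: tens_add tens_scl aff.span_add aff.span_scale aff.span_base)
qed

section \<open>Weights of the affine Cartan subalgebra\<close>

abbreviation "HA \<equiv> aff_cartan H"
abbreviation "RSA \<equiv> aff_root_space L \<kappa> H"

lemma br_aff_cartan:
  assumes "h \<in> H"
  shows "Poly_Mapping.lookup (fst (br A (Poly_Mapping.single 0 h, c, d) z)) n =
      br L h (Poly_Mapping.lookup (fst z) n) + scl L (d * of_int n) (Poly_Mapping.lookup (fst z) n)"
    and "snd (br A (Poly_Mapping.single 0 h, c, d) z) = 0"
proof -
  obtain p u v where z: "z = (p, u, v)" by (cases z)
  have K: "finite {0::int}" "Poly_Mapping.keys (Poly_Mapping.single 0 h) \<subseteq> {0}" by auto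
  show "Poly_Mapping.lookup (fst (br A (Poly_Mapping.single 0 h, c, d) z)) n =
      br L h (Poly_Mapping.lookup (fst z) n) + scl L (d * of_int n) (Poly_Mapping.lookup (fst z) n)"
    unfolding z br_affine[OF K] by (auto simp: lookup_single when_def)
  show "snd (br A (Poly_Mapping.single 0 h, c, d) z) = 0"
    unfolding z br_affine[OF K] by (simp add: zero_prod_def)
qed

lemma aff_cartanI: "h \<in> H \<Longrightarrow> (Poly_Mapping.single 0 h, c, d) \<in> HA"
  by (auto simp: aff_cartan_def)

lemma aff_cartan_add: "y \<in> HA \<Longrightarrow> z \<in> HA \<Longrightarrow> y + z \<in> HA"
  using subspace_cartan by (auto simp: aff_cartan_def single_add[symmetric] intro: subspace_add)

lemma aff_cartan_scl: "z \<in> HA \<Longrightarrow> scl A a z \<in> HA"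
proof -
  assume "z \<in> HA"
  then obtain h c d where z: "z = (Poly_Mapping.single 0 h, c, d)" "h \<in> H" by (auto simp: aff_cartan_def)
  have "scl A a z = (Poly_Mapping.single 0 (scl L a h), a * c, a * d)"
    by (auto simp: scl_affine z lookup_single when_def intro!: poly_mapping_eqI)
  then show ?thesis using z(2) subspace_cartan by (auto simp: aff_cartan_def intro: subspace_scale)
qed

text \<open>The pair \<open>(\<alpha>, k)\<close> stands for the functional \<open>\<alpha> + k \<delta>\<close>.\<close>

definition affw :: "('v \<Rightarrow> complex) \<times> int \<Rightarrow> 'v aff \<Rightarrow> complex" where
  "affw w = (\<lambda>z. if z \<in> HA
     then fst w (Poly_Mapping.lookup (fst z) 0) + of_int (snd w) * snd (snd z) else 0)"

lemma affw_apply: "h \<in> H \<Longrightarrow> affw w (Poly_Mapping.single 0 h, c, d) = fst w h + of_int (snd w) * d"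
  by (simp add: affw_def aff_cartanI)

lemma affw_dual: "fst w \<in> dual_space L H \<Longrightarrow> affw w \<in> dual_space A HA"
proof -
  assume w: "fst w \<in> dual_space L H"
  have "affw w (y + z) = affw w y + affw w z" if yz: "y \<in> HA" "z \<in> HA" for y z
    using yz w unfolding affw_def by (auto simp: aff_cartan_add)
      (auto simp: aff_cartan_def dual_space_def lookup_add algebra_simps)
  moreover have "affw w (scl A a z) = a * affw w z" if z: "z \<in> HA" for a z
    using z w unfolding affw_def by (auto simp: aff_cartan_scl)
      (auto simp: scl_affine aff_cartan_def dual_space_def algebra_simps)
  ultimately show ?thesis unfolding dual_space_def by (auto simp: affw_def)
qed

lemma affw_add: "affw (w + u) = affw w + affw u"
  by (auto simp: affw_def fun_eq_iff algebra_simps)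

lemma affw_inj:
  assumes "fst w \<in> dual_space L H" "fst u \<in> dual_space L H" "affw w = affw u"
  shows "w = u"
proof -
  have *: "fst w h + of_int (snd w) * d = fst u h + of_int (snd u) * d" if "h \<in> H" for h d
    using affw_apply[OF that, of w 0 d] affw_apply[OF that, of u 0 d] assms(3) by simp
  have "fst w = fst u"
    using dual_space_separated[OF assms(1,2)] *[where d = 0] by auto
  moreover have "0 \<in> H" using subspace_cartan by (rule subspace_0)
  then have "snd w = snd u" using *[of 0 1] \<open>fst w = fst u\<close> by simp
  ultimately show ?thesis by (simp add: prod_eq_iff)
qed

lemma tens_root_vector:
  assumes x: "x \<in> RS a"
  shows "tens x k \<in> RSA (affw (a, k))"
proof -
  have "br A (Poly_Mapping.single 0 h, c, d) (tens x k) = scl A (a h + of_int k * d) (tens x k)"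
    if "h \<in> H" for h c d
    using x that
    by (auto simp: br_aff_cartan scl_affine tens_def root_space_def lookup_single
        when_def scale_left_distrib mult.commute zero_prod_def intro!: prod_eqI poly_mapping_eqI)
  then show ?thesis by (auto simp: root_space_def aff_cartan_def affw_apply)
qed

text \<open>Weight 0 is excluded since its weight space also contains \<open>aff_c\<close> and
  \<open>aff_d\<close>. For other weights some element of \<open>HA\<close> acts by a nonzero
  scalar, whereas its brackets have no central or derivation part, so these parts vanish. The action
  of \<open>aff_d\<close> then removes every power of t except \<open>k\<close>.\<close>

lemma aff_root_space_affw:
  assumes a: "a \<in> dual_space L H" and nz: "a \<noteq> 0 \<or> k \<noteq> 0"
  shows "RSA (affw (a, k)) = (\<lambda>x. tens x k) ` RS a"
proof (intro equalityI subsetI)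
  fix z assume z0: "z \<in> RSA (affw (a, k))"
  obtain p u v where zz: "z = (p, u, v)" by (cases z)
  have z: "(p, u, v) \<in> RSA (affw (a, k))" using z0 zz by simp
  have 0: "0 \<in> H" using subspace_cartan by (rule subspace_0)
  have br: "br A (Poly_Mapping.single 0 h, c, d) (p, u, v) = scl A (a h + of_int k * d) (p, u, v)"
    if "h \<in> H" for h c d
    using z aff_cartanI[OF that] affw_apply[OF that, of "(a, k)"] by (auto simp: root_space_def)
  have l: "br L h (Poly_Mapping.lookup p n) + scl L (d * of_int n) (Poly_Mapping.lookup p n)
      = scl L (a h + of_int k * d) (Poly_Mapping.lookup p n)" if "h \<in> H" for h d n
    using br_aff_cartan(1)[OF that, of 0 d "(p, u, v)" n] br[OF that, of 0 d] by (simp add: scl_affine)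
  have uv: "(a h + of_int k * d) * u = 0 \<and> (a h + of_int k * d) * v = 0" if "h \<in> H" for h d
    using br_aff_cartan(2)[OF that, of 0 d "(p, u, v)"] br[OF that, of 0 d]
    by (simp add: scl_affine zero_prod_def)
  have "\<exists>h\<in>H. \<exists>d. a h + of_int k * d \<noteq> 0"
  proof (cases "k = 0")
    case True
    then show ?thesis using nz dual_space_separated[OF a dual_space_0] by auto
  next
    case False
    have "a 0 = a (scl L 0 0)" by simp
    also have "\<dots> = 0" using a 0 unfolding dual_space_def by fastforce
    finally show ?thesis using 0 False by (intro bexI[of _ 0] exI[of _ 1]) auto
  qed
  then have "u = 0" "v = 0" using uv by auto
  moreover have "Poly_Mapping.lookup p n = 0" if "n \<noteq> k" for n
  proof -
    have "scl L (of_int n) (Poly_Mapping.lookup p n) = scl L (of_int k) (Poly_Mapping.lookup p n)"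
      using l[OF 0, where d = 1 and n = n] l[OF 0, where d = 0 and n = n] by (simp add: scale_left_distrib)
    then show ?thesis using that by simp
  qed
  then have "p = Poly_Mapping.single k (Poly_Mapping.lookup p k)"
    by (intro poly_mapping_eqI) (auto simp: lookup_single when_def)
  moreover have "Poly_Mapping.lookup p k \<in> RS a"
    using l[where d = 0 and n = k] by (simp add: root_space_def)
  ultimately show "z \<in> (\<lambda>x. tens x k) ` RS a" unfolding tens_def zz by blast
qed (auto intro: tens_root_vector)

end

section \<open>Positive affine roots and their levels\<close>

context positive_roots
begin

abbreviation "NA \<equiv> aff_n_plus L \<kappa> H P"
abbreviation "BA \<equiv> aff_borel L \<kappa> H P"

text \<open>The pairs \<open>(0, k)\<close> with k > 0 are the imaginary roots k \<delta>;
  \<open>(0, 0)\<close> is left out because 0 is not in \<open>P\<close>.\<close>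

definition pos_weights :: "(('v \<Rightarrow> complex) \<times> int) set" where
  "pos_weights = {(a, k). a \<in> insert 0 R \<and> (k > 0 \<or> k = 0 \<and> a \<in> P)}"

text \<open>The weights of level \<open>k\<close> are those of \<open>D\<^sub>k\<close>.\<close>

definition level :: "('v \<Rightarrow> complex) \<times> int \<Rightarrow> int" where
  "level w = (if fst w \<in> P then snd w else snd w - 1)"

lemma pos_weights_iff:
  "(a, k) \<in> pos_weights \<longleftrightarrow> a \<in> insert 0 R \<and> (k > 0 \<or> k = 0 \<and> a \<in> P)"
  by (simp add: pos_weights_def)

lemma mem_pos_weights:
  "w \<in> pos_weights \<longleftrightarrow> fst w \<in> insert 0 R \<and> (snd w > 0 \<or> snd w = 0 \<and> fst w \<in> P)"
  by (simp add: pos_weights_def case_prod_beta)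

lemma pos_weights_dual: "w \<in> pos_weights \<Longrightarrow> fst w \<in> dual_space L H"
  by (auto simp: pos_weights_def intro: roots_dual)

lemma pos_weights_nonzero: "w \<in> pos_weights \<Longrightarrow> fst w \<noteq> 0 \<or> snd w \<noteq> 0"
  using zero_not_positive by (auto simp: pos_weights_def)

lemma level_nonneg: "w \<in> pos_weights \<Longrightarrow> level w \<ge> 0"
  by (auto simp: pos_weights_def level_def)

lemma aff_root_space_pos_weight:
  assumes "w \<in> pos_weights"
  shows "RSA (affw w) = (\<lambda>x. tens x (snd w)) ` RS (fst w)"
  using aff_root_space_affw[OF pos_weights_dual[OF assms] pos_weights_nonzero[OF assms]] by simp

lemma ex_root_vector:
  assumes "a \<in> insert 0 R"
  obtains x where "x \<in> RS a" "x \<noteq> 0"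
proof (cases "a = 0")
  case True
  have "0 \<in> H" using subspace_cartan by (rule subspace_0)
  then show thesis using that cartan_nonzero True by (auto simp: root_space_0)
next
  case False
  then show thesis using that assms root_vector by auto
qed

lemma n_plus_hat_eq: "NA = aff.span (\<Union>w\<in>pos_weights. RSA (affw w))"
proof
  let ?S = "\<Union>w\<in>pos_weights. RSA (affw w)"
  have "tens x 0 \<in> aff.span ?S" if "x \<in> n_plus L H P" for x
  proof -
    have "(\<lambda>x. tens x 0) ` (\<Union>\<alpha>\<in>P. RS \<alpha>) \<subseteq> ?S"
      by (force simp: pos_weights_iff positive_root intro: tens_root_vector)
    moreover have "tens x 0 \<in> aff.span ((\<lambda>x. tens x 0) ` (\<Union>\<alpha>\<in>P. RS \<alpha>))"
      using that by (intro tens_span) (simp add: n_plus_def)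
    ultimately show ?thesis using aff.span_mono by blast
  qed
  moreover have "tens x k \<in> aff.span ?S" if "k > 0" for x k
  proof -
    have "(\<lambda>x. tens x k) ` (\<Union>\<alpha>\<in>insert 0 R. RS \<alpha>) \<subseteq> ?S"
    proof
      fix z assume "z \<in> (\<lambda>x. tens x k) ` (\<Union>\<alpha>\<in>insert 0 R. RS \<alpha>)"
      then obtain x \<alpha> where "\<alpha> \<in> insert 0 R" "x \<in> RS \<alpha>" "z = tens x k" by blast
      then show "z \<in> ?S"
        using \<open>k > 0\<close> tens_root_vector by (intro UN_I[of "(\<alpha>, k)"]) (auto simp: pos_weights_iff)
    qed
    moreover have "tens x k \<in> aff.span ((\<lambda>x. tens x k) ` (\<Union>\<alpha>\<in>insert 0 R. RS \<alpha>))"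
      by (intro tens_span) (simp only: root_space_decomposition_UNIV UNIV_I)
    ultimately show ?thesis using aff.span_mono by blast
  qed
  ultimately show "NA \<subseteq> aff.span ?S"
    unfolding aff_n_plus_def by (intro aff.span_minimal) auto
  show "aff.span ?S \<subseteq> NA"
    unfolding aff_n_plus_def
  proof (intro aff.span_mono subsetI)
    fix z assume "z \<in> ?S"
    then obtain a k x where w: "(a, k) \<in> pos_weights" "x \<in> RS a" "z = tens x k"
      by (force simp: aff_root_space_pos_weight)
    show "z \<in> {tens x 0 |x. x \<in> n_plus L H P} \<union> {tens x k |x k. k > 0}"
    proof (cases "k > 0")
      case False
      then have "k = 0" "a \<in> P" using w(1) by (auto simp: pos_weights_iff)
      then show ?thesis using w(2,3) by (auto simp: n_plus_def intro!: span_base)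
    qed (use w(3) in auto)
  qed
qed

lemma subspace_n_plus_hat: "aff.subspace NA"
  by (simp add: aff_n_plus_def)

lemma aff_root_space_subset_n_plus: "w \<in> pos_weights \<Longrightarrow> RSA (affw w) \<subseteq> NA"
  unfolding n_plus_hat_eq by (auto intro: aff.span_base)

lemma affw_in_aff_roots:
  assumes "w \<in> pos_weights"
  shows "affw w \<in> aff_roots L \<kappa> H" and "\<exists>z\<in>RSA (affw w). z \<noteq> 0"
proof -
  obtain x where "x \<in> RS (fst w)" "x \<noteq> 0"
    using assms by (auto simp: pos_weights_def intro: ex_root_vector)
  then show *: "\<exists>z\<in>RSA (affw w). z \<noteq> 0"
    using assms by (auto simp: aff_root_space_pos_weight)
  have "affw 0 = 0" by (auto simp: affw_def)
  then have "affw w \<noteq> 0"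
    using affw_inj[OF pos_weights_dual[OF assms], of 0] pos_weights_nonzero[OF assms] by auto
  then show "affw w \<in> aff_roots L \<kappa> H"
    using * affw_dual[OF pos_weights_dual[OF assms]] by (auto simp: roots_def)
qed

lemma aff_pos_roots_eq: "aff_pos_roots L \<kappa> H P = affw ` pos_weights"
proof (intro equalityI subsetI)
  fix \<alpha> assume \<alpha>: "\<alpha> \<in> aff_pos_roots L \<kappa> H P"
  have "0 \<in> RSA \<alpha> \<inter> NA" using aff.subspace_0[OF subspace_n_plus_hat] by (simp add: root_space_def)
  then obtain z where z: "z \<in> RSA \<alpha>" "z \<in> NA" "z \<noteq> 0" using \<alpha> by (auto simp: aff_pos_roots_def)
  have "affw ` pos_weights \<subseteq> dual_space A HA" using affw_dual pos_weights_dual by auto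
  moreover have "\<alpha> \<in> dual_space A HA" using \<alpha> by (auto simp: aff_pos_roots_def roots_def)
  moreover have "z \<in> aff.span (\<Union>\<beta>\<in>affw ` pos_weights. RSA \<beta>)" using z(2) by (simp add: n_plus_hat_eq)
  ultimately show "\<alpha> \<in> affw ` pos_weights" using aff.root_space_meets_span z by blast
next
  fix \<alpha> assume "\<alpha> \<in> affw ` pos_weights"
  then show "\<alpha> \<in> aff_pos_roots L \<kappa> H P"
    using affw_in_aff_roots aff_root_space_subset_n_plus unfolding aff_pos_roots_def by fastforce
qed

lemma aff_lift_eq: "aff_lift H a = affw (a, 0)"
  by (auto simp: aff_lift_def affw_def)

lemma aff_delta_eq: "aff_delta H = affw (0, 1)"
  by (auto simp: aff_delta_def affw_def)

lemma D0_eq: "D0 H P = affw ` {w \<in> pos_weights. level w = 0}"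
proof -
  have lift: "aff_lift H (- \<alpha>) + aff_delta H = affw (- \<alpha>, 1)" for \<alpha>
    by (simp add: aff_lift_eq aff_delta_eq affw_add[symmetric])
  have "{w \<in> pos_weights. level w = 0} = (\<lambda>\<alpha>. (\<alpha>, 0)) ` P \<union> {(0, 1)} \<union> {(- \<alpha>, 1) | \<alpha>. \<alpha> \<in> P}"
    (is "?l = ?r")
  proof (intro equalityI subsetI)
    fix w assume w: "w \<in> ?l"
    obtain a k where ak: "w = (a, k)" by (cases w)
    consider "a \<in> P" | "a = 0" "a \<notin> P" | "a \<in> R" "a \<notin> P" using w ak by (auto simp: pos_weights_iff)
    then show "w \<in> ?r"
    proof cases
      case 3
      then have "- a \<in> P" using positive_uminus by auto
      then have "(- (- a), 1) \<in> {(- \<alpha>, 1::int) | \<alpha>. \<alpha> \<in> P}" by blast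
      then show ?thesis using w ak 3 by (auto simp: level_def)
    qed (use w ak in \<open>auto simp: level_def\<close>)
  next
    fix w assume "w \<in> ?r"
    then show "w \<in> ?l"
      using positive_root roots_uminus positive_uminus zero_not_positive
      by (auto simp: pos_weights_iff level_def)
  qed
  then show ?thesis
    unfolding D0_def lift by (auto simp: aff_lift_eq aff_delta_eq image_Un image_image)
qed

lemma D'_eq: "D' H P = affw ` {w \<in> pos_weights. level w > 0}"
proof -
  have shift: "(\<lambda>z. affw w z + of_nat k * aff_delta H z) = affw (fst w, snd w + int k)" for w k
    by (auto simp: aff_delta_eq affw_def fun_eq_iff algebra_simps)
  have "Dk H P k = (\<lambda>\<alpha> z. \<alpha> z + of_nat k * aff_delta H z) ` D0 H P" for k
    unfolding Dk_def by auto
  then have "Dk H P k = (\<lambda>w. affw (fst w, snd w + int k)) ` {w \<in> pos_weights. level w = 0}" for k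
    by (simp add: D0_eq image_image shift)
  then have "D' H P = affw ` (\<Union>k\<in>{0<..}. (\<lambda>w. (fst w, snd w + int k)) ` {w \<in> pos_weights. level w = 0})"
    unfolding D'_def by (simp add: image_UN image_image)
  also have "(\<Union>k\<in>{0<..}. (\<lambda>w. (fst w, snd w + int k)) ` {w \<in> pos_weights. level w = 0}) =
      {w \<in> pos_weights. level w > 0}"
  proof (intro equalityI subsetI)
    fix w assume w: "w \<in> {w \<in> pos_weights. level w > 0}"
    \<comment> \<open>Removing \<open>level w\<close> copies of \<delta> moves \<open>w\<close> to
      the weight of D with the same finite part.\<close>
    let ?v = "(fst w, snd w - level w)"
    have "?v \<in> pos_weights" "level ?v = 0" using w by (auto simp: pos_weights_def level_def)
    moreover have "w = (fst ?v, snd ?v + int (nat (level w)))" using w by (simp add: prod_eq_iff)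
    moreover have "nat (level w) > 0" using w by simp
    ultimately show "w \<in> (\<Union>k\<in>{0<..}. (\<lambda>w. (fst w, snd w + int k)) ` {w \<in> pos_weights. level w = 0})"
      by blast
  qed (auto simp: pos_weights_def level_def split: if_splits)
  finally show ?thesis .
qed

text \<open>\<open>level\<close> deducts 1 from the degree unless the finite part is in
  \<open>P\<close>. The inequality could fail only if both finite parts were in \<open>P\<close> and
  their sum were not; closure of \<open>P\<close> and \<open>sum_positive_nonzero\<close> exclude
  this.\<close>

lemma level_add:
  assumes "w \<in> pos_weights" "u \<in> pos_weights" "w + u \<in> pos_weights"
  shows "level w + level u \<le> level (w + u)"
proof (cases "fst w \<in> P \<and> fst u \<in> P")
  case True
  then have "fst w + fst u \<noteq> 0"
    using sum_positive_nonzero[of "[fst w, fst u]"] by simp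
  then have "fst w + fst u \<in> P"
    using True assms(3) positive_add by (auto simp: mem_pos_weights)
  then show ?thesis using True by (simp add: level_def)
qed (auto simp: level_def)

text \<open>The delicate case is total degree 0: then both finite parts lie in \<open>P\<close>,
  their sum is nonzero by \<open>sum_positive_nonzero\<close>, and closure returns it to
  \<open>P\<close>.\<close>

lemma pos_weights_add:
  assumes "w \<in> pos_weights" "u \<in> pos_weights" "z \<in> RSA (affw (w + u))" "z \<noteq> 0"
  shows "w + u \<in> pos_weights"
proof -
  have d: "fst (w + u) \<in> dual_space L H"
    using assms(1,2) by (auto intro: dual_space_add pos_weights_dual)
  have nz: "fst (w + u) \<noteq> 0" if "fst w \<in> P" "fst u \<in> P"
    using sum_positive_nonzero[of "[fst w, fst u]"] that by simp
  have s: "snd (w + u) > 0 \<or> snd (w + u) = 0 \<and> fst w \<in> P \<and> fst u \<in> P"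
    using assms(1,2) by (auto simp: pos_weights_def)
  then have "fst (w + u) \<noteq> 0 \<or> snd (w + u) \<noteq> 0" using nz by auto
  then have "RSA (affw (w + u)) = (\<lambda>x. tens x (snd (w + u))) ` RS (fst (w + u))"
    using aff_root_space_affw[OF d, of "snd (w + u)"] by (simp only: prod.collapse)
  then have "z \<in> (\<lambda>x. tens x (snd (w + u))) ` RS (fst (w + u))"
    using assms(3) by simp
  then have "fst (w + u) \<in> insert 0 R"
    using in_rootsI[OF d] assms(4) by auto
  then show ?thesis
    using s nz positive_add by (auto simp: mem_pos_weights)
qed

text \<open>Read off from the explicit bracket: \<open>br_root_space\<close> belongs to
  \<open>lie_algebra\<close>, while the affine algebra is available here as a
  \<open>bilinear_bracket\<close>.\<close>

lemma br_pos_weights: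
  assumes "w \<in> pos_weights" "u \<in> pos_weights" "z \<in> RSA (affw w)" "y \<in> RSA (affw u)"
  shows "br A z y \<in> RSA (affw (w + u))"
proof -
  obtain x where x: "z = tens x (snd w)" "x \<in> RS (fst w)"
    using assms by (auto simp: aff_root_space_pos_weight)
  obtain x' where x': "y = tens x' (snd u)" "x' \<in> RS (fst u)"
    using assms by (auto simp: aff_root_space_pos_weight)
  \<comment> \<open>Nonnegative degrees with sum 0 are both 0, so the factor \<open>of_int k\<close>
    of the cocycle vanishes and no central term appears.\<close>
  have "snd w \<ge> 0" "snd u \<ge> 0" using assms(1,2) by (auto simp: pos_weights_def)
  then have "br A z y = tens (br L x x') (snd (w + u))"
    unfolding x(1) x'(1) br_tens by auto
  moreover have "w + u = (fst w + fst u, snd (w + u))" by (simp add: prod_eq_iff)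
  ultimately show ?thesis
    using tens_root_vector[OF br_root_space[OF x(2) x'(2)], of "snd (w + u)"] by metis
qed

text \<open>Two imaginary weights have to be excluded, since \<open>H\<close> is commutative.
  Otherwise either one factor comes from \<open>H\<close> and acts by a nonzero root value, or the
  finite parts are opposite roots, or they are roots whose sum is a root.\<close>

lemma br_pos_weights_nonzero:
  assumes w: "w \<in> pos_weights" and u: "u \<in> pos_weights" and wu: "w + u \<in> pos_weights"
    and nz: "fst w \<noteq> 0 \<or> fst u \<noteq> 0"
  obtains x y where "x \<in> RSA (affw w)" "y \<in> RSA (affw u)" "br A x y \<noteq> 0"
proof -
  have "\<exists>x\<in>RS (fst w). \<exists>y\<in>RS (fst u). br L x y \<noteq> 0"
  proof -
    have cartan: "\<exists>x\<in>H. \<exists>y\<in>RS b. br L x y \<noteq> 0" if b: "b \<in> R" for b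
    proof -
      obtain y where "y \<in> RS b" "y \<noteq> 0" using b by (rule root_vector)
      moreover have "b \<noteq> 0" using b roots_nonzero by auto
      then obtain h where "h \<in> H" "b h \<noteq> 0"
        using dual_space_separated[OF roots_dual[OF b] dual_space_0] by auto
      ultimately have "br L h y \<noteq> 0" by (simp add: root_space_def)
      with \<open>h \<in> H\<close> \<open>y \<in> RS b\<close> show ?thesis by blast
    qed
    consider "fst w = 0" "fst u \<in> R" | "fst w \<in> R" "fst u = 0"
      | "fst w \<in> R" "fst u = - fst w" | "fst w \<in> R" "fst u \<in> R" "fst w + fst u \<in> R"
      using w u wu nz by (auto simp: mem_pos_weights add_eq_0_iff)
    then show ?thesis
    proof cases
      case 1
      then show ?thesis using cartan by (simp add: root_space_0)
    next
      case 2
      then obtain x y where xy: "x \<in> H" "y \<in> RS (fst w)" "br L x y \<noteq> 0" using cartan by blast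
      then have "br L y x \<noteq> 0" using br_commute[of y x] by simp
      then show ?thesis using xy(1,2) 2(2) root_space_0 by metis
    next
      case 3
      then show ?thesis using root_br_opposite_nonzero[OF 3(1)] by metis
    next
      case 4
      then show ?thesis using root_br_nonzero[OF 4] by metis
    qed
  qed
  then obtain x y where xy: "x \<in> RS (fst w)" "y \<in> RS (fst u)" "br L x y \<noteq> 0" by blast
  have "snd w \<ge> 0" "snd u \<ge> 0" using w u by (auto simp: pos_weights_def)
  then have "br A (tens x (snd w)) (tens y (snd u)) = tens (br L x y) (snd w + snd u)"
    unfolding br_tens by auto
  then have nz: "br A (tens x (snd w)) (tens y (snd u)) \<noteq> 0" using xy by simp
  show thesis
    by (rule that[OF _ _ nz]) (use xy w u in \<open>simp_all add: aff_root_space_pos_weight\<close>)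
qed

section \<open>Thick ideals of the affine Borel subalgebra\<close>

lemma subspace_aff_cartan: "aff.subspace HA"
proof -
  have "0 \<in> HA"
    using aff_cartanI[OF subspace_0[OF subspace_cartan], of 0 0] by (simp add: zero_prod_def)
  then show ?thesis unfolding aff.subspace_def using aff_cartan_add aff_cartan_scl by blast
qed

lemma subspace_borel: "aff.subspace BA"
  and aff_cartan_subset_borel: "HA \<subseteq> BA"
  and n_plus_subset_borel: "NA \<subseteq> BA"
  unfolding aff_borel_def
  using aff.subspace_set_plus aff.subset_set_plus subspace_aff_cartan subspace_n_plus_hat by blast+

text \<open>A single nonzero bracket in \<open>J\<close> suffices, because thickness then fills the
  whole root space.\<close>

lemma thick_ideal_grow:
  assumes J: "lie_ideal A BA J" "thick L \<kappa> H J"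
    and w: "w \<in> pos_weights" and u: "u \<in> pos_weights" "RSA (affw u) \<subseteq> J"
    and v: "v \<in> pos_weights" "v = w + u" and nz: "fst w \<noteq> 0 \<or> fst u \<noteq> 0"
  shows "RSA (affw v) \<subseteq> J"
proof -
  obtain x y where xy: "x \<in> RSA (affw w)" "y \<in> RSA (affw u)" "br A x y \<noteq> 0"
    using br_pos_weights_nonzero[OF w u(1) _ nz] v by metis
  have "x \<in> BA" using xy(1) aff_root_space_subset_n_plus[OF w] n_plus_subset_borel by auto
  then have "br A x y \<in> J" using J(1) u(2) xy(2) by (auto simp: lie_ideal_def)
  moreover have "br A x y \<in> RSA (affw v)" using br_pos_weights[OF w u(1) xy(1,2)] v by simp
  ultimately have "J \<inter> RSA (affw v) \<noteq> {0}" using xy(3) by auto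
  then show ?thesis using J(2) affw_in_aff_roots(1)[OF v(1)] by (auto simp: thick_def)
qed

lemma thick_ideal_contains_upper:
  assumes J: "lie_ideal A BA J" "thick L \<kappa> H J"
    and \<beta>: "\<beta> \<in> D0 H P" "J \<inter> RSA \<beta> \<noteq> {0}"
    and \<gamma>: "\<gamma> \<in> insert (aff_delta H) (D' H P)"
  shows "RSA \<gamma> \<subseteq> J"
proof -
  note grow = thick_ideal_grow[OF J]
  obtain u where u: "u \<in> pos_weights" "level u = 0" "\<beta> = affw u" using \<beta>(1) by (auto simp: D0_eq)
  have uJ: "RSA (affw u) \<subseteq> J"
    using J(2) affw_in_aff_roots(1)[OF u(1)] \<beta>(2) u(3) by (auto simp: thick_def)
  have \<delta>: "(0, 1) \<in> pos_weights" by (simp add: pos_weights_iff)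
  have \<delta>J: "RSA (affw (0, 1)) \<subseteq> J"
  proof (cases "fst u = 0")
    case True
    then have "u = (0, 1)" using u zero_not_positive by (auto simp: level_def prod_eq_iff)
    then show ?thesis using uJ by simp
  next
    case False
    then have "fst u \<in> R" using u by (auto simp: pos_weights_def)
    \<comment> \<open>The complementary weight \<delta> - \<open>u\<close>; it is positive because
      \<open>u\<close> has level 0.\<close>
    then have m: "(- fst u, 1 - snd u) \<in> pos_weights"
      using u(2) roots_uminus[of "fst u"] positive_uminus[of "fst u"]
      by (auto simp: pos_weights_iff level_def split: if_splits)
    show ?thesis
      by (rule grow[OF m u(1) uJ \<delta>]) (use False in \<open>auto simp: prod_eq_iff\<close>)
  qed
  have real: "RSA (affw (b, k)) \<subseteq> J" if b: "b \<in> R" and k: "level (b, k) > 0" for b k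
  proof -
    have "b \<noteq> 0" using b roots_nonzero by auto
    \<comment> \<open>Positive level is exactly what keeps \<open>(b, k - 1)\<close> a positive
      weight, so that \<delta> can be added to it.\<close>
    have m: "(b, k) \<in> pos_weights" "(b, k - 1) \<in> pos_weights"
      using b k by (auto simp: pos_weights_iff level_def split: if_splits)
    show ?thesis
      by (rule grow[OF m(2) \<delta> \<delta>J m(1)]) (use \<open>b \<noteq> 0\<close> in \<open>auto simp: prod_eq_iff\<close>)
  qed
  have imaginary: "RSA (affw (0, k)) \<subseteq> J" if k: "k > 1" for k
  proof -
    obtain b where b: "b \<in> R" using roots_nonempty by auto
    then have "b \<in> P \<or> - b \<in> P" using positive_uminus by blast
    then obtain b where b: "b \<in> P" "b \<in> R" using positive_root by blast
    \<comment> \<open>k \<delta> is split into two real weights. A positive \<open>b\<close> gives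
      \<open>(b, 1)\<close> level 1, so it is covered by \<open>real\<close>, and k > 1 makes
      \<open>(- b, k - 1)\<close> positive.\<close>
    have m: "(- b, k - 1) \<in> pos_weights" "(b, 1) \<in> pos_weights" "(0, k) \<in> pos_weights"
      using b k roots_uminus by (auto simp: pos_weights_iff)
    have bJ: "RSA (affw (b, 1)) \<subseteq> J" using b by (intro real) (auto simp: level_def)
    have "b \<noteq> 0" using b roots_nonzero by auto
    show ?thesis by (rule grow[OF m(1,2) bJ m(3)]) (use \<open>b \<noteq> 0\<close> in auto)
  qed
  consider "\<gamma> = affw (0, 1)" | b k where "\<gamma> = affw (b, k)" "(b, k) \<in> pos_weights" "level (b, k) > 0"
    using \<gamma> by (auto simp: D'_eq aff_delta_eq)
  then show ?thesis
  proof cases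
    case 2
    then show ?thesis
      using real[of b k] imaginary[of k] zero_not_positive by (auto simp: pos_weights_iff level_def)
  qed (use \<delta>J in simp)
qed

text \<open>Degrees are nonnegative, so a vanishing sum has all degrees 0. Then all finite parts lie
  in \<open>P\<close>, which reduces the claim to \<open>sum_positive_nonzero\<close>.\<close>

lemma aff_pos_root_sum_nonzero:
  assumes "set \<xi>s \<subseteq> aff_pos_roots L \<kappa> H P" "\<xi>s \<noteq> []"
  shows "sum_list \<xi>s \<noteq> 0"
proof
  assume 0: "sum_list \<xi>s = 0"
  obtain ws where ws: "\<xi>s = map affw ws" "set ws \<subseteq> pos_weights"
  proof -
    have "\<xi>s \<in> map affw ` lists pos_weights"
      using assms(1) by (simp add: aff_pos_roots_eq lists_image[symmetric] in_lists_conv_set subset_iff)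
    then show thesis using that by auto
  qed
  have "sum_list (map affw ws) = affw (sum_list ws)"
  proof (induction ws)
    case Nil
    show ?case by (auto simp: affw_def)
  qed (simp add: affw_add)
  then have "affw (sum_list ws) = affw 0" using 0 ws(1) by (auto simp: affw_def)
  moreover have "fst (sum_list ws) \<in> dual_space L H"
    using ws(2) by (induction ws) (auto intro: dual_space_add pos_weights_dual)
  ultimately have s: "sum_list ws = 0" using affw_inj[of "sum_list ws" 0] by simp
  have snd: "sum_list (map snd ws) = snd (sum_list ws)" "sum_list (map fst ws) = fst (sum_list ws)"
    by (induction ws) auto
  have "\<forall>w\<in>set ws. snd w \<ge> 0" using ws(2) by (auto simp: pos_weights_def)
  then have "\<forall>w\<in>set ws. snd w = 0"
    using snd(1) s sum_list_nonneg_eq_0_iff[of "map snd ws"] by auto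
  then have "set (map fst ws) \<subseteq> P" using ws(2) by (fastforce simp: mem_pos_weights)
  then show False using sum_positive_nonzero[of "map fst ws"] snd(2) s assms(2) ws(1) by auto
qed

lemma finite_D0: "finite (D0 H P)"
proof -
  have "finite P" using finite_roots positive_root by (meson finite_subset subsetI)
  moreover have "{aff_lift H (- \<alpha>) + aff_delta H | \<alpha>. \<alpha> \<in> P} = (\<lambda>\<alpha>. aff_lift H (- \<alpha>) + aff_delta H) ` P"
    by auto
  ultimately show ?thesis by (simp add: D0_def)
qed

text \<open>The only imaginary root of level 0 is \<delta>, whose root space is a copy of
  \<open>H\<close>. All other elements of D have a root of \<open>L\<close> as finite part.\<close>

lemma real_root_space_one_dimensional:
  assumes "\<beta> \<in> D0 H P" "\<beta> \<noteq> aff_delta H" "e \<in> RSA \<beta>" "e \<noteq> 0" "y \<in> RSA \<beta>"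
  shows "\<exists>c. y = scl A c e"
proof -
  obtain u where u: "u \<in> pos_weights" "level u = 0" "\<beta> = affw u" using assms(1) by (auto simp: D0_eq)
  have "u \<noteq> (0, 1)" using u(3) assms(2) by (auto simp: aff_delta_eq)
  then have "fst u \<noteq> 0"
    using u(2) zero_not_positive by (auto simp: level_def prod_eq_iff)
  then have R: "fst u \<in> R" using u(1) by (auto simp: pos_weights_def)
  obtain x where x: "e = tens x (snd u)" "x \<in> RS (fst u)"
    using assms(3) u by (auto simp: aff_root_space_pos_weight)
  obtain x' where x': "y = tens x' (snd u)" "x' \<in> RS (fst u)"
    using assms(5) u by (auto simp: aff_root_space_pos_weight)
  have "x \<noteq> 0" using assms(4) x by auto
  then obtain c where "x' = scl L c x" using root_space_one_dimensional[OF R x(2) _ x'(2)] by blast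
  then show ?thesis using x x' by (auto simp: tens_scl)
qed

text \<open>Weights of degree at least 2 have positive level, so \<open>I\<close> contains the full
  coefficient space of t^k for k >= 2. The remainder, namely \<open>H\<close>,
  \<open>n_plus\<close>, degree 1, \<open>aff_c\<close> and \<open>aff_d\<close>, is
  finite-dimensional and spanned by \<open>F\<close>.\<close>

lemma aff_borel_finite_codim:
  assumes I: "aff.subspace I" "I \<subseteq> BA" "\<And>\<beta>. \<beta> \<in> D' H P \<Longrightarrow> RSA \<beta> \<subseteq> I"
  shows "\<exists>F. finite F \<and> F \<subseteq> BA \<and> BA = aff.span F + I"
proof -
  obtain F0 where F0: "finite F0" "F0 \<subseteq> n_plus L H P" "n_plus L H P \<subseteq> span F0" by (rule finite_span_subset)
  obtain F1 where F1: "finite F1" "span F1 = UNIV" by (rule finite_span_UNIV)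
  obtain FH where FH: "finite FH" "FH \<subseteq> H" "H \<subseteq> span FH" by (rule finite_span_subset)
  define F where "F = (\<lambda>x. tens x 0) ` FH \<union> (\<lambda>x. tens x 0) ` F0 \<union> (\<lambda>x. tens x 1) ` F1 \<union> {aff_c, aff_d}"
  have "F \<subseteq> BA"
  proof -
    have "tens h 0 \<in> HA" if "h \<in> H" for h using that by (auto simp: tens_def aff_cartan_def)
    moreover have "aff_c \<in> HA" "aff_d \<in> HA"
      using aff_cartanI[OF subspace_0[OF subspace_cartan]] by (auto simp: aff_c_def aff_d_def dest: spec)
    moreover have "tens x 0 \<in> NA" if "x \<in> n_plus L H P" for x
      using that unfolding aff_n_plus_def by (intro aff.span_base) auto
    moreover have "tens x 1 \<in> NA" for x
      unfolding aff_n_plus_def by (intro aff.span_base UnI2) force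
    ultimately show ?thesis
      unfolding F_def using FH(2) F0(2) aff_cartan_subset_borel n_plus_subset_borel by blast
  qed
  moreover have "BA = aff.span F + I"
  proof
    show "aff.span F + I \<subseteq> BA"
      using aff.span_minimal[OF \<open>F \<subseteq> BA\<close> subspace_borel] I(2) subspace_borel
      by (rule aff.set_plus_subset)
    note sub = aff.subspace_set_plus[OF aff.subspace_span I(1), of F]
    note SF = aff.subset_set_plus(1)[OF aff.subspace_span I(1), of F]
    note SI = aff.subset_set_plus(2)[OF aff.subspace_span I(1), of F]
    have tF: "tens x k \<in> aff.span F" if "x \<in> span G" "(\<lambda>x. tens x k) ` G \<subseteq> F" for x k G
      using tens_span[OF that(1)] aff.span_mono[OF that(2)] by auto
    have "tens x k \<in> aff.span F + I" if "k > 0" for x k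
    proof (cases "k = 1")
      case True
      have "tens x 1 \<in> aff.span F" by (rule tF[of x F1]) (auto simp: F1 F_def)
      then show ?thesis using SF True by auto
    next
      case False
      have "RS a \<subseteq> {x. tens x k \<in> I}" if "a \<in> insert 0 R" for a
      proof -
        have "(a, k) \<in> pos_weights" "level (a, k) > 0"
          using that \<open>k > 0\<close> False by (auto simp: pos_weights_iff level_def)
        then have "affw (a, k) \<in> D' H P" by (auto simp: D'_eq)
        from I(3)[OF this] show ?thesis using tens_root_vector by blast
      qed
      then have "(\<Union>a\<in>insert 0 R. RS a) \<subseteq> {x. tens x k \<in> I}" by blast
      moreover have "subspace {x. tens x k \<in> I}"
        using I(1) by (auto simp: subspace_def aff.subspace_def tens_add tens_scl)
      ultimately have "span (\<Union>a\<in>insert 0 R. RS a) \<subseteq> {x. tens x k \<in> I}" by (rule span_minimal)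
      then have "tens x k \<in> I" unfolding root_space_decomposition_UNIV by auto
      then show ?thesis using SI by auto
    qed
    moreover have "tens x 0 \<in> aff.span F + I" if "x \<in> n_plus L H P" for x
    proof -
      have "tens x 0 \<in> aff.span F" using that F0(3) by (intro tF[of x F0]) (auto simp: F_def)
      then show ?thesis using SF by auto
    qed
    ultimately have NF: "NA \<subseteq> aff.span F + I"
      unfolding aff_n_plus_def by (intro aff.span_minimal[OF _ sub]) auto
    have HF: "HA \<subseteq> aff.span F + I"
    proof
      fix z assume "z \<in> HA"
      then obtain h c d where z: "z = (Poly_Mapping.single 0 h, c, d)" "h \<in> H" by (auto simp: aff_cartan_def)
      have "z = tens h 0 + scl A c aff_c + scl A d aff_d"
        by (auto simp: z tens_def aff_c_def aff_d_def scl_affine intro!: poly_mapping_eqI simp: lookup_add)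
      moreover have "tens h 0 \<in> aff.span F" using z(2) FH(3) by (intro tF[of h FH]) (auto simp: F_def)
      moreover have "aff_c \<in> aff.span F" "aff_d \<in> aff.span F" by (auto simp: F_def intro: aff.span_base)
      ultimately have "z \<in> aff.span F" by (auto intro: aff.span_add aff.span_scale)
      then show "z \<in> aff.span F + I" using SF by auto
    qed
    show "BA \<subseteq> aff.span F + I"
      using HF NF sub unfolding aff_borel_def by (rule aff.set_plus_subset)
  qed
  moreover have "finite F" using F0(1) F1(1) FH(1) by (simp add: F_def)
  ultimately show ?thesis by blast
qed

end

section \<open>Basic ideals\<close>

lemma exists_minimal_below:
  assumes X: "finite X" "T \<subseteq> X"
    and trans: "\<And>x y z. x \<in> X \<Longrightarrow> y \<in> X \<Longrightarrow> z \<in> X \<Longrightarrow> le x y \<Longrightarrow> le y z \<Longrightarrow> le x z"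
    and antisym: "\<And>x y. x \<in> X \<Longrightarrow> y \<in> X \<Longrightarrow> le x y \<Longrightarrow> le y x \<Longrightarrow> x = y"
    and refl: "\<And>x. x \<in> X \<Longrightarrow> le x x"
    and x: "x \<in> T"
  shows "\<exists>a\<in>T. le a x \<and> (\<forall>b\<in>T. le b a \<longrightarrow> b = a)"
  using x
proof (induction "card {y \<in> X. le y x}" arbitrary: x rule: less_induct)
  case less
  show ?case
  proof (cases "\<forall>b\<in>T. le b x \<longrightarrow> b = x")
    case True
    then show ?thesis using less.prems refl X by blast
  next
    case False
    then obtain b where b: "b \<in> T" "le b x" "b \<noteq> x" by blast
    have "{y \<in> X. le y b} \<subset> {y \<in> X. le y x}"
    proof
      show "{y \<in> X. le y b} \<subseteq> {y \<in> X. le y x}"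
        using trans[of _ b x] b X less.prems by blast
      have "x \<in> {y \<in> X. le y x}" "x \<notin> {y \<in> X. le y b}"
        using antisym[of b x] refl[of x] b X less.prems by auto
      then show "{y \<in> X. le y b} \<noteq> {y \<in> X. le y x}" by blast
    qed
    then have "card {y \<in> X. le y b} < card {y \<in> X. le y x}"
      using X(1) by (intro psubset_card_mono) auto
    then obtain a where a: "a \<in> T" "le a b" "\<forall>c\<in>T. le c a \<longrightarrow> c = a"
      using less.hyps[OF _ b(1)] by blast
    moreover have "le a x" using trans[of a b x] a b X less.prems by blast
    ultimately show ?thesis by blast
  qed
qed

text \<open>By finiteness an up-set is generated by its minimal elements, so generating the up-set
  \<open>U A\<close> inverts passing to the minimal elements \<open>M T\<close>.\<close>

lemma bij_betw_upsets_antichains: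
  assumes X: "finite X"
    and trans: "\<And>x y z. x \<in> X \<Longrightarrow> y \<in> X \<Longrightarrow> z \<in> X \<Longrightarrow> le x y \<Longrightarrow> le y z \<Longrightarrow> le x z"
    and antisym: "\<And>x y. x \<in> X \<Longrightarrow> y \<in> X \<Longrightarrow> le x y \<Longrightarrow> le y x \<Longrightarrow> x = y"
    and refl: "\<And>x. x \<in> X \<Longrightarrow> le x x"
  shows "bij_betw (\<lambda>T. {a \<in> T. \<forall>b\<in>T. le b a \<longrightarrow> b = a})
    {T. T \<subseteq> X \<and> T \<noteq> {} \<and> (\<forall>a\<in>T. \<forall>b\<in>X. le a b \<longrightarrow> b \<in> T)}
    {A. A \<noteq> {} \<and> antichain_in X le A}"
proof -
  define M where "M = (\<lambda>T. {a \<in> T. \<forall>b\<in>T. le b a \<longrightarrow> b = a})"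
  define U where "U = (\<lambda>A. {x \<in> X. \<exists>a\<in>A. le a x})"
  define \<T> where "\<T> = {T. T \<subseteq> X \<and> T \<noteq> {} \<and> (\<forall>a\<in>T. \<forall>b\<in>X. le a b \<longrightarrow> b \<in> T)}"
  define \<A> where "\<A> = {A. A \<noteq> {} \<and> antichain_in X le A}"
  have min: "\<exists>a\<in>M T. le a x" if T: "T \<subseteq> X" "x \<in> T" for T x
  proof -
    have "\<exists>a\<in>T. le a x \<and> (\<forall>b\<in>T. le b a \<longrightarrow> b = a)"
      by (rule exists_minimal_below[OF X T(1) _ _ _ T(2)]) (fact trans, fact antisym, fact refl)
    then show ?thesis by (auto simp: M_def)
  qed
  have UM: "U (M T) = T" if T: "T \<in> \<T>" for T
  proof (intro equalityI subsetI)
    show "x \<in> T" if "x \<in> U (M T)" for x using that T by (auto simp: U_def M_def \<T>_def)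
    show "x \<in> U (M T)" if "x \<in> T" for x using min[OF _ that] that T by (auto simp: U_def \<T>_def)
  qed
  have MT: "M T \<in> \<A>" if T: "T \<in> \<T>" for T
  proof -
    obtain x where "x \<in> T" using T by (auto simp: \<T>_def)
    then have "M T \<noteq> {}" using min[of T x] T by (auto simp: \<T>_def)
    then show ?thesis using T by (auto simp: \<A>_def \<T>_def antichain_in_def M_def)
  qed
  have MU: "M (U A) = A" if A: "A \<in> \<A>" for A
  proof (intro equalityI subsetI)
    have AX: "A \<subseteq> X" and anti: "\<And>a b. a \<in> A \<Longrightarrow> b \<in> A \<Longrightarrow> le a b \<Longrightarrow> a = b"
      using A by (auto simp: \<A>_def antichain_in_def)
    have AU: "a \<in> U A" if "a \<in> A" for a using that AX refl[of a] by (auto simp: U_def)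
    show "x \<in> A" if x: "x \<in> M (U A)" for x
    proof -
      obtain a where a: "a \<in> A" "le a x" using x by (auto simp: M_def U_def)
      then have "a = x" using x AU[OF a(1)] by (auto simp: M_def)
      then show ?thesis using a by simp
    qed
    show "x \<in> M (U A)" if x: "x \<in> A" for x
    proof -
      have "b = x" if b: "b \<in> U A" "le b x" for b
      proof -
        obtain a where a: "a \<in> A" "le a b" "b \<in> X" using b(1) by (auto simp: U_def)
        have "a \<in> X" "x \<in> X" using a x AX by auto
        have "le a x" by (rule trans[of a b x]) fact+
        then have "a = x" using anti a x by simp
        then have "le x b" using a by simp
        show ?thesis by (rule antisym) fact+
      qed
      then show ?thesis using AU[OF x] by (auto simp: M_def)
    qed
  qed
  have UA: "U A \<in> \<T>" if A: "A \<in> \<A>" for A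
  proof -
    have AX: "A \<subseteq> X" "A \<noteq> {}" using A by (auto simp: \<A>_def antichain_in_def)
    obtain a where "a \<in> A" using AX by auto
    then have "a \<in> U A" using AX refl[of a] by (auto simp: U_def)
    moreover have "y \<in> U A" if xy: "x \<in> U A" "y \<in> X" "le x y" for x y
    proof -
      obtain b where b: "b \<in> A" "le b x" "x \<in> X" using xy(1) by (auto simp: U_def)
      have "b \<in> X" using b AX by auto
      have "le b y" by (rule trans[of b x y]) fact+
      then show ?thesis using b xy by (auto simp: U_def)
    qed
    ultimately show ?thesis by (auto simp: \<T>_def) (auto simp: U_def)
  qed
  have "bij_betw M \<T> \<A>"
    by (rule bij_betw_byWitness[where f' = U]) (use UM MU MT UA in auto)
  then show ?thesis by (simp add: M_def \<T>_def \<A>_def)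
qed

section \<open>Spans of positive root spaces and the order on D\<close>

context positive_roots
begin

abbreviation "D \<equiv> D0 H P"
abbreviation "Du \<equiv> D' H P"
abbreviation "pos \<equiv> aff_pos_roots L \<kappa> H P"
abbreviation "V S \<equiv> aff.span (\<Union>\<beta>\<in>S. RSA \<beta>)"
abbreviation "up \<equiv> up_set L \<kappa> H P"

lemma affw_pos_weights_eqD:
  "affw w = affw u \<Longrightarrow> w \<in> pos_weights \<Longrightarrow> u \<in> pos_weights \<Longrightarrow> w = u"
  using affw_inj pos_weights_dual by blast

lemma affw_pos_weights_addD:
  assumes "affw v = affw w + affw u" "v \<in> pos_weights" "w \<in> pos_weights" "u \<in> pos_weights"
  shows "v = w + u"
proof (rule affw_inj)
  show "fst (w + u) \<in> dual_space L H"
    unfolding fst_add using assms(3,4) by (intro dual_space_add pos_weights_dual)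
qed (use assms in \<open>simp_all add: pos_weights_dual affw_add\<close>)

lemma D0_Un_D': "D \<union> Du = pos"
  using level_nonneg by (fastforce simp: D0_eq D'_eq aff_pos_roots_eq)

lemma D0_disjoint_D': "D \<inter> Du = {}"
  by (auto simp: D0_eq D'_eq dest!: affw_pos_weights_eqD)

lemma D0_subset_pos: "D \<subseteq> pos" and D'_subset_pos: "Du \<subseteq> pos"
  using D0_Un_D' by auto

lemma pos_in_aff_roots: "pos \<subseteq> aff_roots L \<kappa> H"
  by (auto simp: aff_pos_roots_def)

lemma pos_dual: "pos \<subseteq> dual_space A HA"
  using pos_in_aff_roots by (auto simp: roots_def)

lemma pos_root_vector: "\<beta> \<in> pos \<Longrightarrow> \<exists>x\<in>RSA \<beta>. x \<noteq> 0"
  using affw_in_aff_roots(2) by (auto simp: aff_pos_roots_eq)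

lemma n_plus_hat_eq_V: "NA = V pos"
  by (simp add: n_plus_hat_eq aff_pos_roots_eq)

lemma delta_in_D0: "aff_delta H \<in> D"
  by (simp add: D0_def)

lemma pos_add:
  assumes "\<xi> \<in> pos" "\<beta> \<in> pos" "z \<in> RSA (\<xi> + \<beta>)" "z \<noteq> 0"
  shows "\<xi> + \<beta> \<in> pos"
proof -
  obtain w u where wu: "\<xi> = affw w" "\<beta> = affw u" "w \<in> pos_weights" "u \<in> pos_weights"
    using assms(1,2) by (auto simp: aff_pos_roots_eq)
  then have "w + u \<in> pos_weights" using pos_weights_add assms(3,4) by (simp add: affw_add)
  then show ?thesis using wu by (auto simp: aff_pos_roots_eq affw_add[symmetric])
qed

lemma D'_add:
  assumes "\<xi> \<in> pos" "\<beta> \<in> Du" "\<xi> + \<beta> \<in> pos"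
  shows "\<xi> + \<beta> \<in> Du"
proof -
  obtain w u v where wu: "\<xi> = affw w" "\<beta> = affw u" "w \<in> pos_weights" "u \<in> pos_weights" "level u > 0"
    "\<xi> + \<beta> = affw v" "v \<in> pos_weights"
    using assms by (auto simp: aff_pos_roots_eq D'_eq)
  have "v = w + u"
    using affw_pos_weights_addD[of v w u] wu by simp
  then have "level v > 0" using level_add[of w u] level_nonneg[of w] wu by auto
  then show ?thesis using wu by (auto simp: D'_eq)
qed

lemma br_pos:
  assumes "\<xi> \<in> pos" "\<beta> \<in> pos" "x \<in> RSA \<xi>" "y \<in> RSA \<beta>"
  shows "br A x y \<in> RSA (\<xi> + \<beta>)"
proof -
  obtain w u where "\<xi> = affw w" "\<beta> = affw u" "w \<in> pos_weights" "u \<in> pos_weights"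
    using assms(1,2) by (auto simp: aff_pos_roots_eq)
  then show ?thesis using br_pos_weights[of w u x y] assms(3,4) by (simp add: affw_add)
qed

text \<open>The sum of two imaginary positive roots has degree at least 2 and is not in D, so the
  exceptional case of \<open>br_pos_weights_nonzero\<close> cannot occur.\<close>

lemma br_D0_nonzero:
  assumes "\<xi> \<in> pos" "\<beta> \<in> pos" "\<xi> + \<beta> \<in> D"
  shows "\<exists>x\<in>RSA \<xi>. \<exists>y\<in>RSA \<beta>. br A x y \<noteq> 0"
proof -
  obtain w u v where wu: "\<xi> = affw w" "\<beta> = affw u" "w \<in> pos_weights" "u \<in> pos_weights" "level v = 0"
    "\<xi> + \<beta> = affw v" "v \<in> pos_weights"
    using assms by (auto simp: aff_pos_roots_eq D0_eq)
  have v: "v = w + u"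
    using affw_pos_weights_addD[of v w u] wu by simp
  have "fst w \<noteq> 0 \<or> fst u \<noteq> 0"
    using wu(3,4,5) v zero_not_positive by (auto simp: mem_pos_weights level_def)
  then show ?thesis using br_pos_weights_nonzero[of w u] wu v by metis
qed

lemma subspace_V: "aff.subspace (V S)"
  by simp

lemma root_space_meets_V:
  assumes "S \<subseteq> pos" "\<alpha> \<in> aff_roots L \<kappa> H" "V S \<inter> RSA \<alpha> \<noteq> {0}"
  shows "\<alpha> \<in> S"
proof -
  have "0 \<in> V S \<inter> RSA \<alpha>" by (simp add: aff.span_zero root_space_def)
  then obtain z where "z \<in> V S" "z \<in> RSA \<alpha>" "z \<noteq> 0" using assms(3) by auto
  moreover have "\<alpha> \<in> dual_space A HA" using assms(2) by (simp add: roots_def)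
  ultimately show ?thesis using aff.root_space_meets_span[of S HA \<alpha> z] assms(1) pos_dual by auto
qed

lemma root_space_subset_V: "\<beta> \<in> S \<Longrightarrow> RSA \<beta> \<subseteq> V S"
  by (auto intro: aff.span_base)

text \<open>The one-step form of an up-set of \<open>D_le\<close>, matching both
  \<open>up_step\<close> and a single bracket; \<open>up_closed_iff\<close> identifies the two
  notions.\<close>

definition up_closed :: "('v aff \<Rightarrow> complex) set \<Rightarrow> bool" where
  "up_closed T \<longleftrightarrow> T \<subseteq> D \<and> (\<forall>\<xi>\<in>pos. \<forall>\<beta>\<in>T. \<xi> + \<beta> \<in> D \<longrightarrow> \<xi> + \<beta> \<in> T)"

lemma up_step_subset: "up_step L \<kappa> H P \<alpha> i \<subseteq> up \<alpha>"
  by (auto simp: up_set_def)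

lemma up_refl: "\<alpha> \<in> up \<alpha>"
  using up_step_subset[of \<alpha> 0] by simp

lemma up_closed_up:
  assumes "\<alpha> \<in> D"
  shows "up_closed (up \<alpha>)"
  unfolding up_closed_def
proof (intro conjI ballI impI)
  have "up_step L \<kappa> H P \<alpha> i \<subseteq> D" for i using assms by (induction i) auto
  then show "up \<alpha> \<subseteq> D" by (auto simp: up_set_def)
  fix \<xi> \<beta> assume *: "\<xi> \<in> pos" "\<beta> \<in> up \<alpha>" "\<xi> + \<beta> \<in> D"
  then obtain i where "\<beta> \<in> up_step L \<kappa> H P \<alpha> i" by (auto simp: up_set_def)
  then have "\<xi> + \<beta> \<in> up_step L \<kappa> H P \<alpha> (Suc i)" using * by auto
  then show "\<xi> + \<beta> \<in> up \<alpha>" using up_step_subset by blast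
qed

lemma up_least:
  assumes "up_closed T" "\<alpha> \<in> T"
  shows "up \<alpha> \<subseteq> T"
proof -
  have "up_step L \<kappa> H P \<alpha> i \<subseteq> T" for i
    by (induction i) (use assms in \<open>auto simp: up_closed_def\<close>)
  then show ?thesis by (auto simp: up_set_def)
qed

lemma up_closed_iff:
  "up_closed T \<longleftrightarrow> T \<subseteq> D \<and> (\<forall>\<alpha>\<in>T. \<forall>\<beta>\<in>D. D_le L \<kappa> H P \<alpha> \<beta> \<longrightarrow> \<beta> \<in> T)"
proof
  assume T: "up_closed T"
  then show "T \<subseteq> D \<and> (\<forall>\<alpha>\<in>T. \<forall>\<beta>\<in>D. D_le L \<kappa> H P \<alpha> \<beta> \<longrightarrow> \<beta> \<in> T)"
    using up_least[OF T] by (auto simp: D_le_def up_closed_def)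
next
  assume T: "T \<subseteq> D \<and> (\<forall>\<alpha>\<in>T. \<forall>\<beta>\<in>D. D_le L \<kappa> H P \<alpha> \<beta> \<longrightarrow> \<beta> \<in> T)"
  show "up_closed T"
    unfolding up_closed_def
  proof (intro conjI ballI impI)
    fix \<xi> \<beta> assume *: "\<xi> \<in> pos" "\<beta> \<in> T" "\<xi> + \<beta> \<in> D"
    then have "\<xi> + \<beta> \<in> up \<beta>"
      using up_closed_up[of \<beta>] up_refl[of \<beta>] T by (auto simp: up_closed_def)
    then show "\<xi> + \<beta> \<in> T" using T * by (auto simp: D_le_def)
  qed (use T in blast)
qed

lemma D_le_trans:
  assumes "x \<in> D" "D_le L \<kappa> H P x y" "D_le L \<kappa> H P y z"
  shows "D_le L \<kappa> H P x z"
  using up_least[OF up_closed_up[OF assms(1)], of y] assms(2,3) by (auto simp: D_le_def)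

lemma D_le_chain:
  assumes "D_le L \<kappa> H P \<alpha> \<beta>"
  shows "\<exists>\<xi>s. set \<xi>s \<subseteq> pos \<and> \<beta> = sum_list \<xi>s + \<alpha>"
proof -
  have "\<exists>\<xi>s. set \<xi>s \<subseteq> pos \<and> \<beta> = sum_list \<xi>s + \<alpha>" if "\<beta> \<in> up_step L \<kappa> H P \<alpha> i" for i
    using that
  proof (induction i arbitrary: \<beta>)
    case 0
    then show ?case by (intro exI[of _ "[]"]) simp
  next
    case (Suc i)
    show ?case
    proof (cases "\<beta> \<in> up_step L \<kappa> H P \<alpha> i")
      case False
      then obtain \<xi> \<gamma> where \<xi>: "\<xi> \<in> pos" "\<gamma> \<in> up_step L \<kappa> H P \<alpha> i" "\<beta> = \<xi> + \<gamma>"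
        using Suc.prems by auto
      obtain \<xi>s where "set \<xi>s \<subseteq> pos" "\<gamma> = sum_list \<xi>s + \<alpha>" using Suc.IH[OF \<xi>(2)] by blast
      then show ?thesis using \<xi> by (intro exI[of _ "\<xi> # \<xi>s"]) (simp add: add.assoc)
    qed (rule Suc.IH)
  qed
  then show ?thesis using assms by (auto simp: D_le_def up_set_def)
qed

text \<open>Going up from \<open>\<alpha>\<close> to \<open>\<beta>\<close> and back writes 0 as a
  sum of positive roots, which must then be the empty sum.\<close>

lemma D_le_antisym:
  assumes "D_le L \<kappa> H P \<alpha> \<beta>" "D_le L \<kappa> H P \<beta> \<alpha>"
  shows "\<alpha> = \<beta>"
proof -
  obtain xs where xs: "set xs \<subseteq> pos" "\<beta> = sum_list xs + \<alpha>" using D_le_chain[OF assms(1)] by blast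
  obtain ys where ys: "set ys \<subseteq> pos" "\<alpha> = sum_list ys + \<beta>" using D_le_chain[OF assms(2)] by blast
  have "\<alpha> = sum_list ys + (sum_list xs + \<alpha>)" using xs(2) ys(2) by metis
  then have "sum_list (ys @ xs) + \<alpha> = \<alpha>" by (simp only: sum_list_append add.assoc)
  then have "sum_list (ys @ xs) = 0" by (simp only: add_cancel_left_left)
  then have "ys @ xs = []" using aff_pos_root_sum_nonzero[of "ys @ xs"] xs(1) ys(1) by auto
  then show ?thesis using xs(2) by simp
qed

text \<open>A nonzero bracket with a positive root vector has a positive root as weight. Starting in
  \<open>Du\<close> it stays there by \<open>D'_add\<close>; starting in \<open>T\<close> it either
  stays in D, where \<open>up_closed\<close> applies, or enters \<open>Du\<close>. Elements of
  \<open>HA\<close> act by scalars on each root space.\<close>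

lemma lie_ideal_V:
  assumes T: "up_closed T"
  shows "lie_ideal A BA (V (T \<union> Du))"
proof -
  let ?S = "T \<union> Du"
  have S: "?S \<subseteq> pos" using T D0_subset_pos D'_subset_pos by (auto simp: up_closed_def)
  have n: "br A x y \<in> V ?S" if "x \<in> V pos" "y \<in> V ?S" for x y
  proof (rule aff.br_span_closed[OF that subspace_V])
    fix a b assume "a \<in> (\<Union>\<beta>\<in>pos. RSA \<beta>)" "b \<in> (\<Union>\<beta>\<in>?S. RSA \<beta>)"
    then obtain \<xi> \<beta> where \<xi>: "\<xi> \<in> pos" "a \<in> RSA \<xi>" and \<beta>: "\<beta> \<in> ?S" "b \<in> RSA \<beta>" by blast
    have br: "br A a b \<in> RSA (\<xi> + \<beta>)" using br_pos[OF \<xi>(1) _ \<xi>(2) \<beta>(2)] \<beta>(1) S by blast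
    show "br A a b \<in> V ?S"
    proof (cases "br A a b = 0")
      case False
      then have p: "\<xi> + \<beta> \<in> pos" using pos_add[OF \<xi>(1) _ br] \<beta>(1) S by blast
      have "\<xi> + \<beta> \<in> ?S"
        using \<beta>(1) T p D'_add[OF \<xi>(1) _ p] \<xi>(1) D0_Un_D' unfolding up_closed_def by blast
      then show ?thesis using br root_space_subset_V by blast
    qed (simp add: aff.span_zero)
  qed
  have h: "br A x y \<in> V ?S" if "x \<in> HA" "y \<in> V ?S" for x y
  proof (rule aff.br_span_closed[OF aff.span_base that(2) subspace_V])
    show "x \<in> {x}" by simp
    fix a b assume "a \<in> {x}" and b: "b \<in> (\<Union>\<beta>\<in>?S. RSA \<beta>)"
    then obtain \<beta> where "a = x" "\<beta> \<in> ?S" "b \<in> RSA \<beta>" by blast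
    moreover have "b \<in> V ?S" using b by (rule aff.span_base)
    ultimately have "br A a b = scl A (\<beta> x) b" "b \<in> V ?S"
      using that(1) by (auto simp: root_space_def)
    then show "br A a b \<in> V ?S" by (simp add: aff.span_scale)
  qed
  have "br A x y \<in> V ?S" if x: "x \<in> BA" and y: "y \<in> V ?S" for x y
  proof -
    obtain x1 x2 where x12: "x = x1 + x2" "x1 \<in> HA" "x2 \<in> NA"
      using x unfolding aff_borel_def by (rule set_plus_elim)
    then show ?thesis
      using h[of x1 y] n[of x2 y] y by (simp add: aff.br_add_left n_plus_hat_eq_V aff.span_add)
  qed
  moreover have "V ?S \<subseteq> BA"
    using S n_plus_subset_borel aff.span_mono[of "\<Union>\<beta>\<in>?S. RSA \<beta>" "\<Union>\<beta>\<in>pos. RSA \<beta>"]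
    unfolding n_plus_hat_eq_V by blast
  ultimately show ?thesis by (simp add: lie_ideal_def)
qed

lemma strong_idealI:
  assumes "lie_ideal A BA J" "J \<subseteq> NA" "\<And>\<beta>. \<beta> \<in> Du \<Longrightarrow> RSA \<beta> \<subseteq> J"
  shows "strong_ideal L \<kappa> H P J"
  unfolding strong_ideal_def
proof (intro conjI assms(1,2) aff_borel_finite_codim)
  show "aff.subspace J" "J \<subseteq> BA" using assms(1) by (auto simp: lie_ideal_def)
qed (rule assms(3))

lemma supp_V:
  assumes "S \<subseteq> pos"
  shows "supp L \<kappa> H (V S) = S"
proof
  show "supp L \<kappa> H (V S) \<subseteq> S"
  proof
    fix \<alpha> assume \<alpha>: "\<alpha> \<in> supp L \<kappa> H (V S)"
    then have "\<alpha> \<in> aff_roots L \<kappa> H" "V S \<inter> RSA \<alpha> = RSA \<alpha>" by (auto simp: supp_def)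
    moreover have "RSA \<alpha> \<noteq> {0}" using calculation(1) by (simp add: roots_def)
    ultimately show "\<alpha> \<in> S" using root_space_meets_V[OF assms] by metis
  qed
  show "S \<subseteq> supp L \<kappa> H (V S)"
    using assms pos_in_aff_roots root_space_subset_V unfolding supp_def by blast
qed

lemma basic_ideal_V:
  assumes T: "up_closed T" "T \<noteq> {}"
  shows "basic_ideal L \<kappa> H P (V (T \<union> Du))" and "supp L \<kappa> H (V (T \<union> Du)) \<inter> D = T"
proof -
  have S: "T \<union> Du \<subseteq> pos" using T D0_subset_pos D'_subset_pos by (auto simp: up_closed_def)
  show supp: "supp L \<kappa> H (V (T \<union> Du)) \<inter> D = T"
    using supp_V[OF S] T(1) D0_disjoint_D' by (auto simp: up_closed_def)
  have "V (T \<union> Du) \<subseteq> NA" using S unfolding n_plus_hat_eq_V by (intro aff.span_mono) blast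
  then have "strong_ideal L \<kappa> H P (V (T \<union> Du))"
    by (intro strong_idealI lie_ideal_V T(1) root_space_subset_V) auto
  moreover have "thick L \<kappa> H (V (T \<union> Du))"
    unfolding thick_def using root_space_meets_V[OF S] root_space_subset_V by blast
  ultimately show "basic_ideal L \<kappa> H P (V (T \<union> Du))"
    using supp T(2) by (simp add: basic_ideal_def combinatorial_ideal_def)
qed

section \<open>Structure of basic ideals\<close>

lemma basic_ideal_facts:
  assumes J: "basic_ideal L \<kappa> H P J"
  shows "lie_ideal A BA J" "thick L \<kappa> H J" "J \<subseteq> NA" "supp L \<kappa> H J \<inter> D \<noteq> {}" "aff.subspace J"
  using J by (auto simp: basic_ideal_def combinatorial_ideal_def strong_ideal_def lie_ideal_def)

lemma basic_ideal_contains_upper: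
  assumes J: "basic_ideal L \<kappa> H P J" and \<gamma>: "\<gamma> \<in> insert (aff_delta H) Du"
  shows "RSA \<gamma> \<subseteq> J"
proof -
  obtain \<beta> where \<beta>: "\<beta> \<in> supp L \<kappa> H J" "\<beta> \<in> D" using basic_ideal_facts(4)[OF J] by blast
  have "J \<inter> RSA \<beta> \<noteq> {0}"
    using \<beta> pos_root_vector[of \<beta>] D0_subset_pos by (auto simp: supp_def)
  then show ?thesis
    using thick_ideal_contains_upper[OF basic_ideal_facts(1,2)[OF J] \<beta>(2) _ \<gamma>] by blast
qed

lemma basic_ideal_eq_V:
  assumes J: "basic_ideal L \<kappa> H P J"
  shows "J = V (supp L \<kappa> H J \<inter> D \<union> Du)"
proof
  note JF = basic_ideal_facts[OF J]
  have hJ: "br A h x \<in> J" if "h \<in> HA" "x \<in> J" for h x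
    using that JF(1) aff_cartan_subset_borel unfolding lie_ideal_def by blast
  have "J \<subseteq> aff.span (\<Union>\<beta>\<in>pos. J \<inter> RSA \<beta>)" (is "_ \<subseteq> ?K")
  proof (rule aff.root_space_decomposition[OF pos_dual JF(5)])
    show "J \<subseteq> V pos" using JF(3) by (simp only: n_plus_hat_eq_V)
  qed (rule hJ)
  moreover have "?K \<subseteq> V (supp L \<kappa> H J \<inter> D \<union> Du)"
  proof (rule aff.span_minimal[OF UN_least subspace_V])
    fix \<beta> assume \<beta>: "\<beta> \<in> pos"
    show "J \<inter> RSA \<beta> \<subseteq> V (supp L \<kappa> H J \<inter> D \<union> Du)"
    proof (cases "J \<inter> RSA \<beta> = {0}")
      case False
      then have "\<beta> \<in> supp L \<kappa> H J"
        using JF(2) \<beta> pos_in_aff_roots unfolding thick_def supp_def by blast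
      then have "\<beta> \<in> supp L \<kappa> H J \<inter> D \<union> Du" using \<beta> D0_Un_D' by blast
      then have "RSA \<beta> \<subseteq> V (supp L \<kappa> H J \<inter> D \<union> Du)" by (rule root_space_subset_V)
      then show ?thesis by blast
    qed (simp add: aff.span_zero)
  qed
  ultimately show "J \<subseteq> V (supp L \<kappa> H J \<inter> D \<union> Du)" by (rule order_trans)
  have "RSA \<beta> \<subseteq> J" if "\<beta> \<in> supp L \<kappa> H J \<inter> D \<union> Du" for \<beta>
    using that basic_ideal_contains_upper[OF J, of \<beta>] unfolding supp_def by blast
  then have "(\<Union>\<beta>\<in>supp L \<kappa> H J \<inter> D \<union> Du. RSA \<beta>) \<subseteq> J" by (rule UN_least)
  then show "V (supp L \<kappa> H J \<inter> D \<union> Du) \<subseteq> J" by (rule aff.span_minimal[OF _ JF(5)])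
qed

lemma basic_ideal_supp_up_closed:
  assumes J: "basic_ideal L \<kappa> H P J"
  shows "up_closed (supp L \<kappa> H J \<inter> D)"
  unfolding up_closed_def
proof (intro conjI ballI impI)
  fix \<xi> \<beta> assume \<xi>: "\<xi> \<in> pos" and \<beta>: "\<beta> \<in> supp L \<kappa> H J \<inter> D" and D: "\<xi> + \<beta> \<in> D"
  note JF = basic_ideal_facts[OF J]
  have \<beta>p: "\<beta> \<in> pos" using \<beta> D0_subset_pos by blast
  obtain x y where xy: "x \<in> RSA \<xi>" "y \<in> RSA \<beta>" "br A x y \<noteq> 0"
    using br_D0_nonzero[OF \<xi> \<beta>p D] by blast
  have "x \<in> BA" using xy(1) root_space_subset_V[OF \<xi>] n_plus_subset_borel n_plus_hat_eq_V by blast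
  moreover have "y \<in> J" using xy(2) \<beta> by (auto simp: supp_def)
  ultimately have "br A x y \<in> J" using JF(1) by (auto simp: lie_ideal_def)
  then have "J \<inter> RSA (\<xi> + \<beta>) \<noteq> {0}" using xy br_pos[OF \<xi> \<beta>p xy(1,2)] by auto
  then show "\<xi> + \<beta> \<in> supp L \<kappa> H J \<inter> D"
    using D JF(2) D0_subset_pos pos_in_aff_roots unfolding thick_def supp_def by blast
qed simp

lemma root_ideal_eq_V: "root_ideal L \<kappa> H P \<alpha> = V (up \<alpha> \<union> Du)"
  by (simp add: root_ideal_def)

lemma basic_root_ideal: "\<alpha> \<in> D \<Longrightarrow> basic_ideal L \<kappa> H P (root_ideal L \<kappa> H P \<alpha>)"
  unfolding root_ideal_eq_V using up_refl by (intro basic_ideal_V(1) up_closed_up) auto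

lemma root_ideal_subset_if_supp:
  assumes J: "basic_ideal L \<kappa> H P J" and \<alpha>: "\<alpha> \<in> supp L \<kappa> H J \<inter> D"
  shows "root_ideal L \<kappa> H P \<alpha> \<subseteq> J"
proof -
  have "up \<alpha> \<union> Du \<subseteq> supp L \<kappa> H J \<inter> D \<union> Du"
    using up_least[OF basic_ideal_supp_up_closed[OF J] \<alpha>] by blast
  then have "V (up \<alpha> \<union> Du) \<subseteq> V (supp L \<kappa> H J \<inter> D \<union> Du)" by (intro aff.span_mono) blast
  then show ?thesis by (simp only: root_ideal_eq_V basic_ideal_eq_V[OF J, symmetric])
qed

lemma root_ideal_subset:
  assumes J: "basic_ideal L \<kappa> H P J" and \<alpha>: "\<alpha> \<in> D" "J \<inter> RSA \<alpha> \<noteq> {0}"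
  shows "root_ideal L \<kappa> H P \<alpha> \<subseteq> J"
proof (rule root_ideal_subset_if_supp[OF J])
  show "\<alpha> \<in> supp L \<kappa> H J \<inter> D"
    using basic_ideal_facts(2)[OF J] \<alpha> D0_subset_pos pos_in_aff_roots
    unfolding thick_def supp_def by blast
qed

lemma basic_ideal_sum:
  assumes J: "basic_ideal L \<kappa> H P J"
  shows "J = aff.span (\<Union>\<alpha>\<in>D \<inter> supp L \<kappa> H J. root_ideal L \<kappa> H P \<alpha>)"
proof
  let ?K = "aff.span (\<Union>\<alpha>\<in>D \<inter> supp L \<kappa> H J. root_ideal L \<kappa> H P \<alpha>)"
  have K: "root_ideal L \<kappa> H P \<alpha> \<subseteq> ?K" if "\<alpha> \<in> D \<inter> supp L \<kappa> H J" for \<alpha>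
    using that by (intro subsetI aff.span_base) blast
  \<comment> \<open>Every \<open>root_ideal\<close> contains the root spaces of \<open>Du\<close>,
    so one element of the support is enough to cover all of them.\<close>
  obtain \<alpha>0 where \<alpha>0: "\<alpha>0 \<in> D \<inter> supp L \<kappa> H J" using basic_ideal_facts(4)[OF J] by blast
  have "RSA \<beta> \<subseteq> ?K" if \<beta>: "\<beta> \<in> supp L \<kappa> H J \<inter> D \<union> Du" for \<beta>
  proof -
    obtain \<alpha> where \<alpha>: "\<alpha> \<in> D \<inter> supp L \<kappa> H J" "\<beta> \<in> up \<alpha> \<union> Du"
      using \<beta> \<alpha>0 up_refl by blast
    have "RSA \<beta> \<subseteq> root_ideal L \<kappa> H P \<alpha>" unfolding root_ideal_eq_V using \<alpha>(2) by (rule root_space_subset_V)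
    then show ?thesis using K[OF \<alpha>(1)] by blast
  qed
  then have "(\<Union>\<beta>\<in>supp L \<kappa> H J \<inter> D \<union> Du. RSA \<beta>) \<subseteq> ?K" by (rule UN_least)
  then have "V (supp L \<kappa> H J \<inter> D \<union> Du) \<subseteq> ?K" by (rule aff.span_minimal) simp
  then show "J \<subseteq> ?K" by (simp only: basic_ideal_eq_V[OF J, symmetric])
  have "(\<Union>\<alpha>\<in>D \<inter> supp L \<kappa> H J. root_ideal L \<kappa> H P \<alpha>) \<subseteq> J"
    using root_ideal_subset_if_supp[OF J] by blast
  then show "?K \<subseteq> J" using basic_ideal_facts(5)[OF J] by (rule aff.span_minimal)
qed

lemma bij_basic_ideals_upsets:
  "bij_betw (\<lambda>J. supp L \<kappa> H J \<inter> D) {J. basic_ideal L \<kappa> H P J} {T. up_closed T \<and> T \<noteq> {}}"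
proof (rule bij_betw_byWitness[where f' = "\<lambda>T. V (T \<union> Du)"])
  show "\<forall>J\<in>{J. basic_ideal L \<kappa> H P J}. V (supp L \<kappa> H J \<inter> D \<union> Du) = J"
    by (intro ballI basic_ideal_eq_V[symmetric]) simp
  show "\<forall>T\<in>{T. up_closed T \<and> T \<noteq> {}}. supp L \<kappa> H (V (T \<union> Du)) \<inter> D = T"
    using basic_ideal_V(2) by blast
  show "(\<lambda>J. supp L \<kappa> H J \<inter> D) ` {J. basic_ideal L \<kappa> H P J} \<subseteq> {T. up_closed T \<and> T \<noteq> {}}"
    using basic_ideal_supp_up_closed basic_ideal_facts(4) by blast
  show "(\<lambda>T. V (T \<union> Du)) ` {T. up_closed T \<and> T \<noteq> {}} \<subseteq> {J. basic_ideal L \<kappa> H P J}"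
    using basic_ideal_V(1) by blast
qed

lemma bij_basic_ideals_antichains:
  "\<exists>f. bij_betw f {J. basic_ideal L \<kappa> H P J} {A. A \<noteq> {} \<and> antichain_in D (D_le L \<kappa> H P) A}"
proof (rule exI, rule bij_betw_trans[OF bij_basic_ideals_upsets])
  have eq: "{T. up_closed T \<and> T \<noteq> {}} =
      {T. T \<subseteq> D \<and> T \<noteq> {} \<and> (\<forall>a\<in>T. \<forall>b\<in>D. D_le L \<kappa> H P a b \<longrightarrow> b \<in> T)}"
    by (auto simp: up_closed_iff)
  show "bij_betw (\<lambda>T. {a \<in> T. \<forall>b\<in>T. D_le L \<kappa> H P b a \<longrightarrow> b = a}) {T. up_closed T \<and> T \<noteq> {}}
      {A. A \<noteq> {} \<and> antichain_in D (D_le L \<kappa> H P) A}"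
    unfolding eq
  proof (rule bij_betw_upsets_antichains[OF finite_D0])
    show "D_le L \<kappa> H P x z" if "x \<in> D" "D_le L \<kappa> H P x y" "D_le L \<kappa> H P y z" for x y z
      using that by (rule D_le_trans)
    show "x = y" if "D_le L \<kappa> H P x y" "D_le L \<kappa> H P y x" for x y
      using that by (rule D_le_antisym)
    show "D_le L \<kappa> H P x x" for x by (simp add: D_le_def up_refl)
  qed
qed

section \<open>Submodules of the quotient of the nilradical\<close>

abbreviation "I\<delta> \<equiv> root_ideal L \<kappa> H P (aff_delta H)"

text \<open>Thickness is automatic above \<open>i(\<delta>)\<close>: the roots of \<open>D\<close> other than \<open>\<delta>\<close> are real, so
  their root spaces are one-dimensional.\<close>

lemma basic_ideal_above_delta:
  assumes J: "lie_ideal A BA J" "J \<subseteq> NA" "I\<delta> \<subseteq> J"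
  shows "basic_ideal L \<kappa> H P J"
proof -
  have upper: "RSA \<beta> \<subseteq> J" if "\<beta> \<in> insert (aff_delta H) Du" for \<beta>
    using that J(3) up_refl root_space_subset_V[of \<beta> "up (aff_delta H) \<union> Du"]
    unfolding root_ideal_eq_V by blast
  have sub: "aff.subspace J" using J(1) by (simp add: lie_ideal_def)
  have "thick L \<kappa> H J"
    unfolding thick_def
  proof (intro ballI impI)
    fix \<alpha> assume \<alpha>: "\<alpha> \<in> aff_roots L \<kappa> H" "J \<inter> RSA \<alpha> \<noteq> {0}"
    have "0 \<in> J \<inter> RSA \<alpha>" using aff.subspace_0[OF sub] by (simp add: root_space_def)
    then obtain e where e: "e \<in> J" "e \<in> RSA \<alpha>" "e \<noteq> 0" using \<alpha>(2) by auto
    then have p: "\<alpha> \<in> pos" using \<alpha>(1) J(2) by (auto simp: aff_pos_roots_def)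
    show "RSA \<alpha> \<subseteq> J"
    proof (cases "\<alpha> \<in> insert (aff_delta H) Du")
      case False
      then have "\<alpha> \<in> D" "\<alpha> \<noteq> aff_delta H" using p D0_Un_D' by auto
      then show ?thesis
        using real_root_space_one_dimensional[OF _ _ e(2,3)] e(1) aff.subspace_scale[OF sub] by blast
    qed (rule upper)
  qed
  moreover have "strong_ideal L \<kappa> H P J" using J upper by (intro strong_idealI) auto
  moreover have "aff_delta H \<in> supp L \<kappa> H J \<inter> D"
    using upper delta_in_D0 D0_subset_pos pos_in_aff_roots by (auto simp: supp_def)
  ultimately show ?thesis by (auto simp: basic_ideal_def combinatorial_ideal_def)
qed

lemma basic_ideal_contains_delta: "basic_ideal L \<kappa> H P J \<Longrightarrow> I\<delta> \<subseteq> J"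
  using basic_ideal_contains_upper[of J "aff_delta H"] delta_in_D0 D0_subset_pos pos_in_aff_roots
  by (intro root_ideal_subset_if_supp) (auto simp: supp_def)

text \<open>The correspondence theorem for quotient modules, with \<open>Union\<close> as preimage
  under the projection. It applies since \<open>basic_ideal_contains_delta\<close> and
  \<open>basic_ideal_above_delta\<close> identify basic ideals with the ideals between
  \<open>I\<delta>\<close> and \<open>NA\<close>.\<close>

lemma bij_basic_ideals_submodules:
  "bij_betw (\<lambda>J. (\<lambda>x. x +o I\<delta>) ` J) {J. basic_ideal L \<kappa> H P J}
    {N. quotient_submodule A BA NA I\<delta> N}"
proof (rule bij_betw_byWitness[where f' = Union])
  have I: "lie_ideal A BA I\<delta>" "aff.subspace I\<delta>"
    using basic_ideal_facts(1,5)[OF basic_root_ideal[OF delta_in_D0]] by auto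
  have scl: "scl A a ` (x +o I\<delta>) + I\<delta> = scl A a x +o I\<delta>" for a x
    by (rule aff.coset_image[OF I(2)]) (simp add: aff.scale_right_distrib aff.subspace_scale[OF I(2)])
  \<comment> \<open>\<open>I\<delta>\<close> is an ideal of \<open>BA\<close>, so the action does
    not depend on the representative of the coset.\<close>
  have br: "br A z ` (x +o I\<delta>) + I\<delta> = br A z x +o I\<delta>" if "z \<in> BA" for z x
    by (rule aff.coset_image[OF I(2)]) (use that I(1) in \<open>simp add: aff.br_add_right lie_ideal_def\<close>)
  show "\<forall>J\<in>{J. basic_ideal L \<kappa> H P J}. \<Union> ((\<lambda>x. x +o I\<delta>) ` J) = J"
  proof safe
    fix J x i assume J: "basic_ideal L \<kappa> H P J"
    show "i \<in> J" if x: "x \<in> J" and i: "i \<in> x +o I\<delta>"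
    proof -
      obtain c where c: "c \<in> I\<delta>" "i = x + c" using i unfolding elt_set_plus_def by blast
      have "c \<in> J" using c(1) basic_ideal_contains_delta[OF J] by blast
      then show ?thesis unfolding c(2) by (rule aff.subspace_add[OF basic_ideal_facts(5)[OF J] x])
    qed
    show "x \<in> \<Union> ((\<lambda>x. x +o I\<delta>) ` J)" if "x \<in> J" using that aff.coset_self[OF I(2)] by blast
  qed
  have coset: "\<exists>x\<in>NA. X = x +o I\<delta>" if "quotient_submodule A BA NA I\<delta> N" "X \<in> N" for N X
    using that by (auto simp: quotient_submodule_def)
  have coset_of: "x +o I\<delta> \<in> N" if N: "quotient_submodule A BA NA I\<delta> N" "x \<in> \<Union>N" for N x
  proof -
    obtain X where "X \<in> N" "x \<in> X" using N(2) by blast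
    then show ?thesis using coset[OF N(1)] aff.coset_eqI[OF I(2)] by metis
  qed
  have in_Union: "x \<in> \<Union>N" if "x +o I\<delta> \<in> N" for N x
    using that aff.coset_self[OF I(2)] by blast
  show "\<forall>N\<in>{N. quotient_submodule A BA NA I\<delta> N}. (\<lambda>x. x +o I\<delta>) ` \<Union>N = N"
  proof (intro ballI equalityI subsetI)
    fix N X assume "N \<in> {N. quotient_submodule A BA NA I\<delta> N}"
    then have N: "quotient_submodule A BA NA I\<delta> N" by simp
    show "X \<in> N" if "X \<in> (\<lambda>x. x +o I\<delta>) ` \<Union>N" using that coset_of[OF N] by blast
    show "X \<in> (\<lambda>x. x +o I\<delta>) ` \<Union>N" if "X \<in> N" using that coset[OF N] in_Union by blast
  qed
  show "(\<lambda>J. (\<lambda>x. x +o I\<delta>) ` J) ` {J. basic_ideal L \<kappa> H P J} \<subseteq> {N. quotient_submodule A BA NA I\<delta> N}"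
  proof safe
    fix J assume J: "basic_ideal L \<kappa> H P J"
    note JF = basic_ideal_facts[OF J]
    show "quotient_submodule A BA NA I\<delta> ((\<lambda>x. x +o I\<delta>) ` J)"
      unfolding quotient_submodule_def
    proof (intro conjI ballI allI)
      show "(\<lambda>x. x +o I\<delta>) ` J \<subseteq> {x +o I\<delta> | x. x \<in> NA}" using JF(3) by blast
      show "I\<delta> \<in> (\<lambda>x. x +o I\<delta>) ` J"
        using aff.subspace_0[OF JF(5)] by (intro image_eqI[of _ _ 0]) simp_all
    next
      fix X Y assume "X \<in> (\<lambda>x. x +o I\<delta>) ` J" "Y \<in> (\<lambda>x. x +o I\<delta>) ` J"
      then obtain x y where xy: "X = x +o I\<delta>" "Y = y +o I\<delta>" "x \<in> J" "y \<in> J" by blast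
      show "X + Y \<in> (\<lambda>x. x +o I\<delta>) ` J"
        unfolding xy(1,2) aff.coset_add[OF I(2)]
        by (intro imageI aff.subspace_add[OF JF(5)] xy(3,4))
    next
      fix a X assume "X \<in> (\<lambda>x. x +o I\<delta>) ` J"
      then obtain x where x: "X = x +o I\<delta>" "x \<in> J" by blast
      show "scl A a ` X + I\<delta> \<in> (\<lambda>x. x +o I\<delta>) ` J"
        unfolding x(1) scl by (intro imageI aff.subspace_scale[OF JF(5)] x(2))
    next
      fix z X assume z: "z \<in> BA" and "X \<in> (\<lambda>x. x +o I\<delta>) ` J"
      then obtain x where x: "X = x +o I\<delta>" "x \<in> J" by blast
      have "br A z x \<in> J" using JF(1) z x(2) unfolding lie_ideal_def by blast
      then show "br A z ` X + I\<delta> \<in> (\<lambda>x. x +o I\<delta>) ` J"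
        unfolding x(1) br[OF z] by (rule imageI)
    qed
  qed
  show "Union ` {N. quotient_submodule A BA NA I\<delta> N} \<subseteq> {J. basic_ideal L \<kappa> H P J}"
  proof safe
    fix N assume N: "quotient_submodule A BA NA I\<delta> N"
    have I_NA: "I\<delta> \<subseteq> NA" by (rule basic_ideal_facts(3)[OF basic_root_ideal[OF delta_in_D0]])
    have NA: "\<Union>N \<subseteq> NA"
    proof
      fix y assume "y \<in> \<Union>N"
      then obtain x where x: "x \<in> NA" "y \<in> x +o I\<delta>" using coset[OF N] by blast
      then obtain c where c: "c \<in> I\<delta>" "y = x + c" unfolding elt_set_plus_def by blast
      have "c \<in> NA" using c(1) I_NA by blast
      then show "y \<in> NA" unfolding c(2) by (rule aff.subspace_add[OF subspace_n_plus_hat x(1)])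
    qed
    \<comment> \<open>The zero coset supplies both 0 and the inclusion of \<open>I\<delta>\<close>
      in the union, the latter being the hypothesis of
      \<open>basic_ideal_above_delta\<close>.\<close>
    have IN: "I\<delta> \<in> N" using N by (simp add: quotient_submodule_def)
    have "aff.subspace (\<Union>N)"
      unfolding aff.subspace_def
    proof (intro conjI ballI allI)
      show "0 \<in> \<Union>N" using IN aff.subspace_0[OF I(2)] by blast
      show "x + y \<in> \<Union>N" if "x \<in> \<Union>N" "y \<in> \<Union>N" for x y
      proof -
        have "(x +o I\<delta>) + (y +o I\<delta>) \<in> N"
          using N coset_of[OF N] that unfolding quotient_submodule_def by blast
        then show ?thesis unfolding aff.coset_add[OF I(2)] by (rule in_Union)
      qed
      show "scl A a x \<in> \<Union>N" if "x \<in> \<Union>N" for a x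
      proof -
        have "scl A a ` (x +o I\<delta>) + I\<delta> \<in> N"
          using N coset_of[OF N that] unfolding quotient_submodule_def by blast
        then show ?thesis unfolding scl by (rule in_Union)
      qed
    qed
    moreover have "br A z x \<in> \<Union>N" if "z \<in> BA" "x \<in> \<Union>N" for z x
    proof -
      have "br A z ` (x +o I\<delta>) + I\<delta> \<in> N"
        using N coset_of[OF N that(2)] that(1) unfolding quotient_submodule_def by blast
      then show ?thesis unfolding br[OF that(1)] by (rule in_Union)
    qed
    ultimately have "lie_ideal A BA (\<Union>N)"
      using NA n_plus_subset_borel unfolding lie_ideal_def by blast
    then show "basic_ideal L \<kappa> H P (\<Union>N)"
      using NA IN by (intro basic_ideal_above_delta) auto
  qed
qed

end

theorem theorem4:
  fixes L :: "'g::ab_group_add lie"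
    and \<kappa> :: "'g \<Rightarrow> 'g \<Rightarrow> complex"
    and H :: "'g set"
    and P :: "('g \<Rightarrow> complex) set"
  assumes "simple_lie_algebra L"
    and "finite_dimensional L"
    and "invariant_form L \<kappa>"
    and "cartan_subalgebra L H"
    and "positive_system L H P"
  shows
    "(\<forall>\<alpha>\<in>D0 H P. basic_ideal L \<kappa> H P (root_ideal L \<kappa> H P \<alpha>)) \<and>
     (\<forall>J. basic_ideal L \<kappa> H P J \<longrightarrow>
        (\<forall>\<alpha>\<in>D0 H P. J \<inter> aff_root_space L \<kappa> H \<alpha> \<noteq> {0} \<longrightarrow> root_ideal L \<kappa> H P \<alpha> \<subseteq> J)) \<and>
     (\<forall>J. basic_ideal L \<kappa> H P J \<longrightarrow>
        J = lspan (affine L \<kappa>) (\<Union>\<alpha>\<in>D0 H P \<inter> supp L \<kappa> H J. root_ideal L \<kappa> H P \<alpha>)) \<and>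
     (\<exists>f. bij_betw f {J. basic_ideal L \<kappa> H P J}
        {A. A \<noteq> {} \<and> antichain_in (D0 H P) (D_le L \<kappa> H P) A}) \<and>
     (\<exists>f. bij_betw f {J. basic_ideal L \<kappa> H P J}
        {N. quotient_submodule (affine L \<kappa>) (aff_borel L \<kappa> H P) (aff_n_plus L \<kappa> H P)
              (root_ideal L \<kappa> H P (aff_delta H)) N})"
proof -
  interpret positive_roots L \<kappa> H P
    by (intro positive_roots.intro cartan_decomposition.intro cartan_decomposition_axioms.intro
        positive_roots_axioms.intro assms)
  show ?thesis
    using basic_root_ideal root_ideal_subset basic_ideal_sum bij_basic_ideals_antichains
      exI[where x = "\<lambda>J. (\<lambda>x. x +o I\<delta>) ` J" and
        P = "\<lambda>f. bij_betw f {J. basic_ideal L \<kappa> H P J} {N. quotient_submodule A BA NA I\<delta> N}",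
        OF bij_basic_ideals_submodules]
    by (intro conjI allI impI ballI)
qed

end
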